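(* Let $\Delta^{G}$ be a $\pi$-connection of degree $s$ on $\mathrm{GL}_n$. For every non-degenerate curve $c^{(0)}\in R^n$ there exists a unique non-degenerate curve $c\in R^n$ such that $c$ is a geodesic for $\Delta^{G}$ and $c\equiv c^{(0)}$ mod $p$ and $\delta^{(s)}c \equiv \delta^{(s)}c^{(0)}$ mod $p$.
   Context: $p$ odd prime; $R$ the $p$-adic completion of the ring of integers of the maximal unramified extension of $\mathbb Q_p$, $K=R[1/p]$; $\phi$ the unique Frobenius lift on $R$; for $a\in R$, $a^{\phi^s}=\phi^s(a)=a^{p^s}+p\,\delta^{(s)}a$ defines $\delta^{(s)}a$ (componentwise on vectors). $\pi$ is a prime element of a finite Galois extension of $\mathbb Q_p$, $R_\pi=R[\pi]$, and $[K(\pi):K]=n$; fix an $R$-basis $\theta_1,\ldots,\theta_n$ of $R_\pi$ and write $p/\pi=\sum_l r_l\theta_l$, $r_l\in R$. Fix $s\ge1$ and an $n$-tuple $\delta_1^{(s)},\ldots,\delta_n^{(s)}$ of higher $\pi$-derivations of degree $s$ on $R_\pi$ (maps $\delta$ with $\delta(1)=0$, $\delta(x+y)=\delta x+\delta y+\frac p\pi C^{(s)}_p(x,y)$, $\delta(xy)=x^{p^s}\delta y+y^{p^s}\delta x+\pi\delta x\delta y$, $C^{(s)}_p(X,Y)=(X^{p^s}+Y^{p^s}-(X+Y)^{p^s})/p$). Let $x$ be an $n\times n$ matrix of indeterminates, $\mathcal A=R_\pi[x,\det(x)^{-1}]^{\widehat{\ }}$ ($p$-adic completion), and for $F\in\mathcal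 A$ let $F(1)\in R_\pi$ be its image under $x\mapsto 1$. A $\pi$-connection of degree $s$ on $\mathrm{GL}_n$ is an $n$-tuple of higher $\pi$-derivations $(\delta_i^{(s)})^G$ of degree $s$ on $\mathcal A$ extending $\delta_i^{(s)}$. A curve is $c\in R^n$; $c^*:R_\pi\to R$ is the $R$-linear map $\sum a_i\theta_i\mapsto\sum a_ic_i$, and $F_c:=c^*(F(1))$. The velocity of $c$ is $v=\delta^{(s)}c$, and $\delta_v^{G}=\sum_i v_i^{\phi^s}(\delta_i^{(s)})^G$. $c$ is a geodesic if $(\delta_v^G(xv))_c=0$ (entrywise). $c$ is non-degenerate if $\sum_lr_lc_l\not\equiv0$ and $\sum_lv_l\not\equiv0$ mod $p$. *)

theory Defs
  imports
    "HOL-Analysis.Determinants"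
    "HOL-Library.Poly_Mapping"
    "HOL-Computational_Algebra.Primes"
    "HOL-Computational_Algebra.Polynomial"
    "HOL-Computational_Algebra.Fraction_Field"
begin

section \<open>Subrings, subfields and homomorphisms between them\<close>

definition is_subring :: "'a::comm_ring_1 set \<Rightarrow> bool" where
  "is_subring A \<longleftrightarrow> 1 \<in> A \<and> (\<forall>x\<in>A. \<forall>y\<in>A. x - y \<in> A \<and> x * y \<in> A)"

definition is_subfield :: "'a::field set \<Rightarrow> bool" where
  "is_subfield F \<longleftrightarrow> is_subring F \<and> (\<forall>x\<in>F. inverse x \<in> F)"

definition ring_hom_on :: "'a::comm_ring_1 set \<Rightarrow> 'b::comm_ring_1 set \<Rightarrow> ('a \<Rightarrow> 'b) \<Rightarrow> bool" where
  "ring_hom_on A B f \<longleftrightarrow> f ` A \<subseteq> B \<and> f 1 = 1 \<and>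
     (\<forall>x\<in>A. \<forall>y\<in>A. f (x + y) = f x + f y \<and> f (x * y) = f x * f y)"

definition cong_in :: "'a::comm_ring_1 set \<Rightarrow> 'a \<Rightarrow> 'a \<Rightarrow> 'a \<Rightarrow> bool" where
  "cong_in A m x y \<longleftrightarrow> (\<exists>t\<in>A. x - y = m * t)"

definition fraction_field :: "'a::field set \<Rightarrow> 'a set" where
  "fraction_field A = {a / b |a b. a \<in> A \<and> b \<in> A \<and> b \<noteq> 0}"

definition polys_over :: "'a::comm_ring_1 set \<Rightarrow> 'a poly set" where
  "polys_over A = {f. \<forall>i. coeff f i \<in> A}"

definition ring_adjoin :: "'a::comm_ring_1 set \<Rightarrow> 'a \<Rightarrow> 'a set" where
  "ring_adjoin A x = {poly f x |f. f \<in> polys_over A}"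

definition field_adjoin :: "'a::field set \<Rightarrow> 'a \<Rightarrow> 'a set" where
  "field_adjoin F x = fraction_field (ring_adjoin F x)"

definition integral_closure :: "'a::comm_ring_1 set \<Rightarrow> 'a set \<Rightarrow> 'a set" where
  "integral_closure A L = {x \<in> L. \<exists>f \<in> polys_over A. lead_coeff f = 1 \<and> poly f x = 0}"

definition is_basis :: "'a::comm_ring_1 set \<Rightarrow> 'i set \<Rightarrow> ('i \<Rightarrow> 'a) \<Rightarrow> 'a set \<Rightarrow> bool" where
  "is_basis A I b V \<longleftrightarrow> finite I \<and>
     V = {\<Sum>i\<in>I. a i * b i |a. \<forall>i\<in>I. a i \<in> A} \<and>
     (\<forall>a. (\<forall>i\<in>I. a i \<in> A) \<and> (\<Sum>i\<in>I. a i * b i) = 0 \<longrightarrow> (\<forall>i\<in>I. a i = 0))"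

definition extension_degree :: "'a::field set \<Rightarrow> 'a set \<Rightarrow> nat \<Rightarrow> bool" where
  "extension_degree F L n \<longleftrightarrow> is_subfield F \<and> is_subfield L \<and> F \<subseteq> L \<and>
     (\<exists>b::nat \<Rightarrow> 'a. is_basis F {..<n} b L)"

definition finite_extension :: "'a::field set \<Rightarrow> 'a set \<Rightarrow> bool" where
  "finite_extension F L \<longleftrightarrow> (\<exists>n. extension_degree F L n)"

definition field_auts :: "'a::field set \<Rightarrow> 'a set \<Rightarrow> ('a \<Rightarrow> 'a) set" where
  "field_auts F L = {\<sigma>. ring_hom_on L L \<sigma> \<and> bij_betw \<sigma> L L \<and> (\<forall>x\<in>F. \<sigma> x = x)}"

definition finite_galois :: "'a::field set \<Rightarrow> 'a set \<Rightarrow> bool" where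
  "finite_galois F L \<longleftrightarrow> finite_extension F L \<and> {x \<in> L. \<forall>\<sigma> \<in> field_auts F L. \<sigma> x = x} = F"


section \<open>\<open>p\<close>-adic completion\<close>

definition padically_complete :: "nat \<Rightarrow> 'a::comm_ring_1 set \<Rightarrow> bool" where
  "padically_complete p A \<longleftrightarrow>
     (\<forall>x\<in>A. (\<forall>m. cong_in A (of_nat p ^ m) x 0) \<longrightarrow> x = 0) \<and>
     (\<forall>u::nat \<Rightarrow> 'a. (\<forall>m. u m \<in> A) \<and> (\<forall>m. cong_in A (of_nat p ^ m) (u (Suc m)) (u m)) \<longrightarrow>
        (\<exists>x\<in>A. \<forall>m. cong_in A (of_nat p ^ m) x (u m)))"

text \<open>\<open>A\<close>, with the structure map \<open>h\<close>, is the inverse limit of the rings \<open>B / p\<^sup>mB\<close>: it is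
  \<open>p\<close>-adically complete and separated, and \<open>h\<close> induces isomorphisms
  \<open>B / p\<^sup>mB \<rightarrow> A / p\<^sup>mA\<close> for all \<open>m\<close>.\<close>

definition is_padic_completion ::
  "nat \<Rightarrow> 'b::comm_ring_1 set \<Rightarrow> ('b \<Rightarrow> 'a::comm_ring_1) \<Rightarrow> 'a set \<Rightarrow> bool" where
  "is_padic_completion p B h A \<longleftrightarrow>
     is_subring B \<and> is_subring A \<and> ring_hom_on B A h \<and> padically_complete p A \<and>
     (\<forall>m. \<forall>x\<in>A. \<exists>b\<in>B. cong_in A (of_nat p ^ m) x (h b)) \<and>
     (\<forall>m. \<forall>b\<in>B. cong_in A (of_nat p ^ m) (h b) 0 \<longrightarrow> cong_in B (of_nat p ^ m) b 0)"


section \<open>The rings \<open>R\<close> and \<open>R\<^sub>\<pi>\<close>\<close>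

text \<open>All arithmetic rings live in one algebraically closed ambient field of characteristic \<open>0\<close>.
  It contains an algebraic closure of \<open>\<rat>\<^sub>p\<close>, so extensions of \<open>\<rat>\<^sub>p\<close> are subfields of it.\<close>

definition is_Zp :: "nat \<Rightarrow> 'k::field_char_0 set \<Rightarrow> bool" where
  "is_Zp p Zp \<longleftrightarrow> is_padic_completion p (\<int> :: 'k set) id Zp"

text \<open>A prime element in the sense of local fields: a generator of the maximal ideal.\<close>

definition prime_element :: "'k::field set \<Rightarrow> 'k \<Rightarrow> bool" where
  "prime_element A \<pi> \<longleftrightarrow> \<pi> \<noteq> 0 \<and> \<pi> \<in> A \<and> {x \<in> A. \<not> (\<exists>y\<in>A. x * y = 1)} = {\<pi> * y |y. y \<in> A}"

text \<open>Ramification index \<open>1\<close>; separability of the residue extension is automatic, because the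
  residue field of \<open>\<int>\<^sub>p\<close> is finite.\<close>

definition finite_unramified :: "nat \<Rightarrow> 'k::field_char_0 set \<Rightarrow> 'k set \<Rightarrow> bool" where
  "finite_unramified p Zp L \<longleftrightarrow>
     finite_extension (fraction_field Zp) L \<and> prime_element (integral_closure Zp L) (of_nat p)"

definition unramified :: "nat \<Rightarrow> 'k::field_char_0 set \<Rightarrow> 'k set \<Rightarrow> bool" where
  "unramified p Zp M \<longleftrightarrow>
     is_subfield M \<and> (\<forall>x\<in>M. \<exists>L. finite_unramified p Zp L \<and> x \<in> L \<and> L \<subseteq> M)"

definition maximal_unramified ::
  "nat \<Rightarrow> 'k::{alg_closed_field,field_char_0} set \<Rightarrow> 'k set \<Rightarrow> bool" where
  "maximal_unramified p Zp M \<longleftrightarrow> unramified p Zp M \<and> (\<forall>N. unramified p Zp N \<longrightarrow> N \<subseteq> M)"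

definition is_completed_Zp_ur ::
  "nat \<Rightarrow> 'k::{alg_closed_field,field_char_0} set \<Rightarrow> 'k set \<Rightarrow> bool" where
  "is_completed_Zp_ur p Zp R \<longleftrightarrow>
     (\<exists>M. maximal_unramified p Zp M \<and> is_padic_completion p (integral_closure Zp M) id R)"

definition frobenius_lift :: "nat \<Rightarrow> 'k::field set \<Rightarrow> ('k \<Rightarrow> 'k) \<Rightarrow> bool" where
  "frobenius_lift p R \<phi> \<longleftrightarrow> ring_hom_on R R \<phi> \<and> (\<forall>a\<in>R. cong_in R (of_nat p) (\<phi> a) (a ^ p))"

definition delta :: "nat \<Rightarrow> ('k::field \<Rightarrow> 'k) \<Rightarrow> nat \<Rightarrow> 'k \<Rightarrow> 'k" where
  "delta p \<phi> s a = ((\<phi> ^^ s) a - a ^ (p ^ s)) / of_nat p"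


section \<open>Higher \<open>\<pi>\<close>-derivations\<close>

text \<open>The integer polynomial \<open>(X\<^sup>q + Y\<^sup>q - (X + Y)\<^sup>q) / p\<close> with \<open>q = p\<^sup>s\<close>, evaluated in a ring in which
  one cannot divide by \<open>p\<close>.\<close>

definition C_poly :: "nat \<Rightarrow> nat \<Rightarrow> 'a::comm_ring_1 \<Rightarrow> 'a \<Rightarrow> 'a" where
  "C_poly p s x y = - (\<Sum>k\<in>{0<..<p ^ s}. of_nat ((p ^ s choose k) div p) * x ^ k * y ^ (p ^ s - k))"

lemma C_poly_eq:
  fixes x y :: "'a::comm_ring_1"
  assumes "prime p"
  shows "of_nat p * C_poly p s x y = x ^ (p ^ s) + y ^ (p ^ s) - (x + y) ^ (p ^ s)"
proof -
  define q where "q = p ^ s"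
  have q: "q > 0" using assms by (simp add: q_def prime_gt_0_nat)
  have dv: "p dvd (q choose k)" if k: "k \<in> {0<..<q}" for k
  proof (rule ccontr)
    assume "\<not> p dvd (q choose k)"
    then have "coprime (p ^ s) (q choose k)"
      using assms by (simp add: prime_imp_coprime)
    moreover have "k * (q choose k) = q * ((q - 1) choose (k - 1))"
      using k times_binomial_minus1_eq by auto
    then have "p ^ s dvd k * (q choose k)" by (simp add: q_def)
    ultimately have "p ^ s dvd k" by (simp add: coprime_dvd_mult_left_iff)
    then show False using k by (auto simp: q_def dest: dvd_imp_le)
  qed
  have split: "{..q} = insert 0 (insert q {0<..<q})" using q by auto
  have "(x + y) ^ q = (\<Sum>k\<le>q. of_nat (q choose k) * x ^ k * y ^ (q - k))"
    by (rule binomial_ring)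
  also have "\<dots> = x ^ q + y ^ q + (\<Sum>k\<in>{0<..<q}. of_nat (q choose k) * x ^ k * y ^ (q - k))"
    unfolding split using q by simp
  also have "(\<Sum>k\<in>{0<..<q}. of_nat (q choose k) * x ^ k * y ^ (q - k)) =
    (\<Sum>k\<in>{0<..<q}. of_nat p * (of_nat ((q choose k) div p) * x ^ k * y ^ (q - k)))"
  proof (intro sum.cong refl)
    fix k assume "k \<in> {0<..<q}"
    then have "(of_nat (q choose k) :: 'a) = of_nat p * of_nat ((q choose k) div p)"
      using dv by (metis dvd_mult_div_cancel of_nat_mult)
    then show "of_nat (q choose k) * x ^ k * y ^ (q - k) =
        of_nat p * (of_nat ((q choose k) div p) * x ^ k * y ^ (q - k))"
      by (simp add: mult.assoc)
  qed
  also have "\<dots> = - (of_nat p * C_poly p s x y)"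
    by (simp add: C_poly_def q_def sum_distrib_left)
  finally show ?thesis by (simp add: q_def)
qed

text \<open>In the next definition \<open>\<pi>\<close> and \<open>\<rho>\<close> stand for the images of \<open>\<pi>\<close> and \<open>p / \<pi>\<close> in the ring \<open>A\<close>.\<close>

definition higher_pi_derivation ::
  "nat \<Rightarrow> nat \<Rightarrow> 'a::comm_ring_1 \<Rightarrow> 'a \<Rightarrow> 'a set \<Rightarrow> ('a \<Rightarrow> 'a) \<Rightarrow> bool" where
  "higher_pi_derivation p s \<pi> \<rho> A \<delta> \<longleftrightarrow>
     \<delta> ` A \<subseteq> A \<and> \<delta> 1 = 0 \<and>
     (\<forall>x\<in>A. \<forall>y\<in>A. \<delta> (x + y) = \<delta> x + \<delta> y + \<rho> * C_poly p s x y) \<and>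
     (\<forall>x\<in>A. \<forall>y\<in>A. \<delta> (x * y) = x ^ (p ^ s) * \<delta> y + y ^ (p ^ s) * \<delta> x + \<pi> * \<delta> x * \<delta> y)"


section \<open>The ring \<open>R\<^sub>\<pi>[x, det(x)\<^sup>-\<^sup>1]\<close> and its completion\<close>

text \<open>Polynomials in the indeterminates \<open>x\<^sub>i\<^sub>j\<close>; a monomial is its matrix of exponents.\<close>

type_synonym ('n, 'k) matpoly = "('n \<Rightarrow>\<^sub>0 'n \<Rightarrow>\<^sub>0 nat) \<Rightarrow>\<^sub>0 'k"

definition matpoly_const :: "'k::zero \<Rightarrow> ('n, 'k) matpoly" where
  "matpoly_const a = Poly_Mapping.single 0 a"

definition matpoly_vars :: "('n::finite, 'k::comm_ring_1) matpoly ^ 'n ^ 'n" where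
  "matpoly_vars = (\<chi> i j. Poly_Mapping.single (Poly_Mapping.single i (Poly_Mapping.single j 1)) 1)"

lemma matpoly_monomial:
  fixes f :: "'n::finite \<Rightarrow> 'n"
  assumes "finite I"
  shows "(\<Prod>i\<in>I. matpoly_vars $ i $ f i) =
    (Poly_Mapping.single (\<Sum>i\<in>I. Poly_Mapping.single i (Poly_Mapping.single (f i) 1)) 1
      :: ('n::finite, 'k::comm_ring_1) matpoly)"
  using assms
  by (induction I rule: finite_induct) (simp_all add: matpoly_vars_def mult_single)

lemma det_matpoly_vars_nonzero:
  "det matpoly_vars \<noteq> (0 :: ('n::{finite,linorder}, 'k::idom) matpoly)"
proof -
  define e :: "('n \<Rightarrow> 'n) \<Rightarrow> 'n \<Rightarrow>\<^sub>0 'n \<Rightarrow>\<^sub>0 nat" where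
    "e = (\<lambda>f. \<Sum>i\<in>UNIV. Poly_Mapping.single i (Poly_Mapping.single (f i) 1))"
  have e_lookup: "Poly_Mapping.lookup (e f) i = Poly_Mapping.single (f i) 1" for f i
  proof -
    have "Poly_Mapping.lookup (e f) i =
      (\<Sum>j\<in>UNIV. Poly_Mapping.lookup (Poly_Mapping.single j (Poly_Mapping.single (f j) (1::nat))) i)"
      unfolding e_def by (simp add: lookup_sum)
    also have "\<dots> = (\<Sum>j\<in>UNIV. if j = i then Poly_Mapping.single (f j) 1 else 0)"
      by (intro sum.cong) (auto simp: lookup_single when_def)
    finally show ?thesis by simp
  qed
  have e_id: "e f = e id \<longleftrightarrow> f = id" for f
  proof
    assume "e f = e id"
    then have "Poly_Mapping.single (f i) (1::nat) = Poly_Mapping.single i 1" for i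
      using e_lookup[of f i] e_lookup[of id i] by simp
    then have "Poly_Mapping.lookup (Poly_Mapping.single (f i) (1::nat)) i = 1" for i
      by simp
    then have "f i = i" for i
      by (metis lookup_single_not_eq zero_neq_one)
    then show "f = id" by auto
  qed simp
  have "Poly_Mapping.lookup (det matpoly_vars :: ('n, 'k) matpoly) (e id) =
    (\<Sum>f | f permutes (UNIV :: 'n set). Poly_Mapping.lookup
       (of_int (sign f) * Poly_Mapping.single (e f) (1::'k)) (e id))"
    unfolding det_def e_def by (simp add: lookup_sum matpoly_monomial)
  also have "\<dots> = (\<Sum>f | f permutes (UNIV :: 'n set). if f = id then 1 else 0)"
  proof (intro sum.cong refl)
    fix f :: "'n \<Rightarrow> 'n"
    have "(of_int (sign f) :: ('n, 'k) matpoly) * Poly_Mapping.single (e f) 1 =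
      Poly_Mapping.single (e f) (of_int (sign f))"
      by (simp add: sign_def single_uminus)
    then show "Poly_Mapping.lookup (of_int (sign f) * Poly_Mapping.single (e f) (1::'k)) (e id) =
      (if f = id then 1 else 0)"
      by (auto simp: lookup_single when_def e_id)
  qed
  also have "\<dots> = 1"
    by (subst sum.delta) (auto simp: permutes_id finite_permutations)
  finally show ?thesis by auto
qed

definition GL_ring :: "'k::idom set \<Rightarrow> ('n::{finite,linorder}, 'k) matpoly fract set" where
  "GL_ring B = {Fract f (det matpoly_vars ^ m) |f m. \<forall>e. Poly_Mapping.lookup f e \<in> B}"

text \<open>Below, \<open>h\<close> is the structure map from the ring \<open>R\<^sub>\<pi>[x, det(x)\<^sup>-\<^sup>1]\<close> to its completion.\<close>

definition const_image ::
  "(('n::{finite,linorder}, 'k::idom) matpoly fract \<Rightarrow> 'a::comm_ring_1) \<Rightarrow> 'k \<Rightarrow> 'a" where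
  "const_image h a = h (Fract (matpoly_const a) 1)"

definition coord_matrix ::
  "(('n::{finite,linorder}, 'k::idom) matpoly fract \<Rightarrow> 'a::comm_ring_1) \<Rightarrow> (('a, 'n) vec, 'n) vec" where
  "coord_matrix h = (\<chi> i j. h (Fract (matpoly_vars $ i $ j) 1))"

text \<open>\<open>ev\<close> is \<open>F \<mapsto> F(1)\<close>. A homomorphism of \<open>R\<^sub>\<pi>\<close>-algebras is \<open>p\<close>-adically continuous and \<open>R\<^sub>\<pi>\<close> is
  \<open>p\<close>-adically separated, so these conditions determine \<open>ev\<close> on \<open>A\<close>.\<close>

definition eval_at_one ::
  "'k::idom set \<Rightarrow> (('n::{finite,linorder}, 'k) matpoly fract \<Rightarrow> 'a::comm_ring_1) \<Rightarrow> 'a set \<Rightarrow>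
     ('a \<Rightarrow> 'k) \<Rightarrow> bool" where
  "eval_at_one B h A ev \<longleftrightarrow> ring_hom_on A B ev \<and> (\<forall>b\<in>B. ev (const_image h b) = b) \<and>
     (\<chi> i j. ev (coord_matrix h $ i $ j)) = mat 1"

definition pi_connection ::
  "nat \<Rightarrow> nat \<Rightarrow> 'k::field \<Rightarrow> 'k set \<Rightarrow> (('n::{finite,linorder}, 'k) matpoly fract \<Rightarrow> 'a::comm_ring_1) \<Rightarrow>
     'a set \<Rightarrow> ('n \<Rightarrow> 'k \<Rightarrow> 'k) \<Rightarrow> ('n \<Rightarrow> 'a \<Rightarrow> 'a) \<Rightarrow> bool" where
  "pi_connection p s \<pi> B h A \<delta> \<delta>G \<longleftrightarrow>
     (\<forall>i. higher_pi_derivation p s (const_image h \<pi>) (const_image h (of_nat p / \<pi>)) A (\<delta>G i) \<and>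
          (\<forall>b\<in>B. \<delta>G i (const_image h b) = const_image h (\<delta> i b)))"


section \<open>Curves and geodesics\<close>

definition curves :: "'k set \<Rightarrow> ('k ^ 'n) set" where
  "curves R = {c. \<forall>i. c $ i \<in> R}"

definition velocity :: "nat \<Rightarrow> ('k::field \<Rightarrow> 'k) \<Rightarrow> nat \<Rightarrow> 'k ^ 'n \<Rightarrow> 'k ^ 'n" where
  "velocity p \<phi> s c = (\<chi> i. delta p \<phi> s (c $ i))"

definition coords :: "'k::comm_ring_1 set \<Rightarrow> ('n::finite \<Rightarrow> 'k) \<Rightarrow> 'k \<Rightarrow> 'k ^ 'n" where
  "coords R \<theta> y = (THE a. a \<in> curves R \<and> y = (\<Sum>i\<in>UNIV. a $ i * \<theta> i))"

definition curve_pullback :: "'k::comm_ring_1 set \<Rightarrow> ('n::finite \<Rightarrow> 'k) \<Rightarrow> 'k ^ 'n \<Rightarrow> 'k \<Rightarrow> 'k" where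
  "curve_pullback R \<theta> c y = (\<Sum>i\<in>UNIV. coords R \<theta> y $ i * c $ i)"

definition directional ::
  "(('n::{finite,linorder}, 'k::idom) matpoly fract \<Rightarrow> 'a::comm_ring_1) \<Rightarrow> ('k \<Rightarrow> 'k) \<Rightarrow> nat \<Rightarrow>
     ('n \<Rightarrow> 'a \<Rightarrow> 'a) \<Rightarrow> ('k, 'n) vec \<Rightarrow> 'a \<Rightarrow> 'a" where
  "directional h \<phi> s \<delta>G v F = (\<Sum>i\<in>UNIV. const_image h ((\<phi> ^^ s) (v $ i)) * \<delta>G i F)"

definition geodesic ::
  "nat \<Rightarrow> ('k::field \<Rightarrow> 'k) \<Rightarrow> nat \<Rightarrow> 'k set \<Rightarrow> ('n::{finite,linorder} \<Rightarrow> 'k) \<Rightarrow>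
     (('n, 'k) matpoly fract \<Rightarrow> 'a::comm_ring_1) \<Rightarrow> ('a \<Rightarrow> 'k) \<Rightarrow> ('n \<Rightarrow> 'a \<Rightarrow> 'a) \<Rightarrow> ('k, 'n) vec \<Rightarrow> bool" where
  "geodesic p \<phi> s R \<theta> h ev \<delta>G c \<longleftrightarrow>
     (let v = velocity p \<phi> s c;
          xv = coord_matrix h *v (\<chi> j. const_image h (v $ j))
      in \<forall>k. curve_pullback R \<theta> c (ev (directional h \<phi> s \<delta>G v (xv $ k))) = 0)"

definition nondegenerate ::
  "nat \<Rightarrow> ('k::field \<Rightarrow> 'k) \<Rightarrow> nat \<Rightarrow> 'k set \<Rightarrow> 'k ^ 'n \<Rightarrow> 'k ^ 'n \<Rightarrow> bool" where
  "nondegenerate p \<phi> s R r c \<longleftrightarrow>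
     \<not> cong_in R (of_nat p) (\<Sum>l\<in>UNIV. r $ l * c $ l) 0 \<and>
     \<not> cong_in R (of_nat p) (\<Sum>l\<in>UNIV. velocity p \<phi> s c $ l) 0"

definition vec_cong :: "'k::comm_ring_1 set \<Rightarrow> nat \<Rightarrow> 'k ^ 'n \<Rightarrow> 'k ^ 'n \<Rightarrow> bool" where
  "vec_cong R p c d \<longleftrightarrow> (\<forall>i. cong_in R (of_nat p) (c $ i) (d $ i))"

end

theory Submission
  imports Defs
begin

text \<open>Put \<open>\<sigma> = \<phi>\<^sup>s\<close> and \<open>q = p\<^sup>s\<close>. For a higher \<open>\<pi>\<close>-derivation \<open>\<delta>\<close> the map \<open>x \<mapsto> x\<^sup>q + \<pi> \<delta> x\<close> is a
  ring homomorphism; on \<open>R\<close> it equals \<open>\<sigma>\<close>, because the residue field of \<open>R\<close> is perfect and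
  \<open>R\<^sub>\<pi>\<close> is \<open>\<pi>\<close>-adically separated. Hence the geodesic equation reads
  \<open>(\<Sum>\<^sub>i \<sigma> v\<^sub>i) (\<Sum>\<^sub>l r\<^sub>l c\<^sub>l) \<delta>\<^sup>(\<^sup>s\<^sup>)v\<^sub>k + \<Sum>\<^sub>i\<^sub>j \<sigma> v\<^sub>i \<sigma> v\<^sub>j c\<^sup>*(\<Gamma>\<^sub>i\<^sub>k\<^sub>j) = 0\<close>, where non-degeneracy makes the
  coefficient of \<open>\<delta>\<^sup>(\<^sup>s\<^sup>)v\<^sub>k\<close> a unit. Since \<open>\<sigma>\<close> is bijective on \<open>R\<close>, the system for \<open>(c, v)\<close> with
  \<open>v = \<delta>\<^sup>(\<^sup>s\<^sup>)c\<close> becomes a fixed point equation for a \<open>p\<close>-adic contraction of a residue class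
  modulo \<open>p\<close>.\<close>

section \<open>Subrings and congruences\<close>

text \<open>\<open>R\<close> and \<open>R\<pi>\<close> are given purely algebraically, without a
  valuation or an explicit residue field. Perfectness modulo \<open>p\<close> and the divisibility
  of some power of \<pi> by \<open>p\<close> have a common source: for integral \<open>x\<close> the
  ring \<open>Zp[x]\<close> is finite modulo \<open>p\<close>, so powers of \<open>x\<close> repeat
  there. The second fact reduces \<pi>-adic separation of \<open>R\<pi>\<close> to
  \<open>p\<close>-adic separation, which a free \<open>R\<close>-module inherits from
  \<open>R\<close>. The velocity has to be an independent unknown: \<delta> divides by
  \<open>p\<close>, so a congruence of curves modulo \<open>p^m\<close> controls their velocities
  only modulo \<open>p^(m-1)\<close>. For the pair (c, v) nothing is divided by \<open>p\<close>:
  the inverse of \<sigma> preserves congruences modulo every \<open>p^m\<close>, while raising to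
  the power q and multiplying by \<open>p\<close> each gain a factor \<open>p\<close>. Since c
  modulo \<open>p\<close> does not determine v modulo \<open>p\<close>, both residues are
  prescribed.\<close>

lemma subring_one: "is_subring A \<Longrightarrow> 1 \<in> A"
  by (simp add: is_subring_def)

lemma subring_diff: "is_subring A \<Longrightarrow> x \<in> A \<Longrightarrow> y \<in> A \<Longrightarrow> x - y \<in> A"
  by (simp add: is_subring_def)

lemma subring_mult: "is_subring A \<Longrightarrow> x \<in> A \<Longrightarrow> y \<in> A \<Longrightarrow> x * y \<in> A"
  by (simp add: is_subring_def)

lemma subring_zero: "is_subring A \<Longrightarrow> 0 \<in> A"
  using subring_diff[of A 1 1] subring_one by fastforce

lemma subring_uminus: "is_subring A \<Longrightarrow> x \<in> A \<Longrightarrow> - x \<in> A"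
  using subring_diff[of A 0 x] subring_zero by fastforce

lemma subring_add: "is_subring A \<Longrightarrow> x \<in> A \<Longrightarrow> y \<in> A \<Longrightarrow> x + y \<in> A"
  using subring_diff[of A x "- y"] subring_uminus by fastforce

lemma subring_power: "is_subring A \<Longrightarrow> x \<in> A \<Longrightarrow> x ^ k \<in> A"
  by (induction k) (auto intro: subring_one subring_mult)

lemma subring_of_nat: "is_subring A \<Longrightarrow> of_nat k \<in> A"
  by (induction k) (auto intro: subring_zero subring_one subring_add)

lemma subring_sum: "is_subring A \<Longrightarrow> (\<And>i. i \<in> I \<Longrightarrow> f i \<in> A) \<Longrightarrow> sum f I \<in> A"
  by (induction I rule: infinite_finite_induct) (auto intro: subring_zero subring_add)

lemmas subring_intros = subring_zero subring_one subring_diff subring_mult subring_uminus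
  subring_add subring_power subring_of_nat subring_sum

lemma cong_inI: "t \<in> A \<Longrightarrow> x - y = m * t \<Longrightarrow> cong_in A m x y"
  by (auto simp: cong_in_def)

lemma cong_in_refl: "is_subring A \<Longrightarrow> cong_in A m x x"
  by (rule cong_inI[of 0]) (auto intro: subring_zero)

lemma cong_in_sym:
  assumes "is_subring A" "cong_in A m x y"
  shows "cong_in A m y x"
proof -
  obtain t where "t \<in> A" "x - y = m * t" using assms(2) by (auto simp: cong_in_def)
  then show ?thesis
    by (intro cong_inI[of "- t"]) (auto intro: subring_uminus assms(1) simp: algebra_simps)
qed

lemma cong_in_add:
  assumes "is_subring A" "cong_in A m x y" "cong_in A m x' y'"
  shows "cong_in A m (x + x') (y + y')"
proof -
  obtain t t' where "t \<in> A" "x - y = m * t" "t' \<in> A" "x' - y' = m * t'"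
    using assms by (auto simp: cong_in_def)
  then show ?thesis
    by (intro cong_inI[of "t + t'"]) (auto intro: subring_add assms(1) simp: algebra_simps)
qed

lemma cong_in_trans:
  assumes "is_subring A" "cong_in A m x y" "cong_in A m y z"
  shows "cong_in A m x z"
  using cong_in_add[OF assms] by (simp add: cong_in_def)

lemma cong_in_uminus:
  assumes "is_subring A" "cong_in A m x y"
  shows "cong_in A m (- x) (- y)"
  using cong_in_sym[OF assms] by (simp add: cong_in_def)

lemma cong_in_mult:
  assumes "is_subring A" "cong_in A m x y" "cong_in A m x' y'" "x \<in> A" "y' \<in> A"
  shows "cong_in A m (x * x') (y * y')"
proof -
  obtain t t' where t: "t \<in> A" "x - y = m * t" "t' \<in> A" "x' - y' = m * t'"
    using assms by (auto simp: cong_in_def)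
  have "x * x' - y * y' = x * (x' - y') + (x - y) * y'" by (simp add: algebra_simps)
  also have "\<dots> = m * (x * t' + t * y')" by (simp add: t algebra_simps)
  finally show ?thesis
    by (rule cong_inI[rotated]) (use assms t in \<open>auto intro!: subring_intros\<close>)
qed

lemma cong_in_power:
  assumes "is_subring A" "cong_in A m x y" "x \<in> A" "y \<in> A"
  shows "cong_in A m (x ^ k) (y ^ k)"
  by (induction k) (auto intro: cong_in_refl cong_in_mult subring_power assms)

lemma cong_in_sum:
  assumes "is_subring A" "\<And>i. i \<in> I \<Longrightarrow> cong_in A m (f i) (g i)"
  shows "cong_in A m (sum f I) (sum g I)"
  using assms(2)
  by (induction I rule: infinite_finite_induct) (auto intro: cong_in_refl cong_in_add assms(1))

lemma cong_in_scale: "cong_in A m x y \<Longrightarrow> cong_in A (n * m) (n * x) (n * y)"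
  by (auto simp: cong_in_def right_diff_distrib[symmetric] mult.assoc)

lemma cong_in_dvd_modulus:
  assumes "is_subring A" "cong_in A (m * n) x y" "n \<in> A"
  shows "cong_in A m x y"
  using assms by (auto simp: cong_in_def mult.assoc intro: subring_mult)

lemma cong_in_power_le:
  assumes "is_subring A" "cong_in A (m ^ k) x y" "m \<in> A" "j \<le> k"
  shows "cong_in A (m ^ j) x y"
  by (rule cong_in_dvd_modulus[of _ _ "m ^ (k - j)"])
    (use assms in \<open>auto intro: subring_power simp: power_add[symmetric]\<close>)

lemma cong_in_mono: "cong_in A m x y \<Longrightarrow> A \<subseteq> B \<Longrightarrow> cong_in B m x y"
  by (auto simp: cong_in_def)

text \<open>Each p-th power gains a factor \<pi>: in \<open>x^p - y^p = (x - y) * S\<close> the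
  cofactor S is congruent to \<open>p * y^(p-1)\<close> modulo \<pi>, and \<pi> divides
  \<open>p\<close>. The exponent \<open>Suc m\<close> ensures that x and y agree modulo \<pi> at the
  start.\<close>

lemma cong_in_prime_power_raise:
  fixes \<pi> \<rho> x y :: "'a::comm_ring_1"
  assumes A: "is_subring A" and "\<pi> \<in> A" "\<rho> \<in> A" "\<pi> * \<rho> = of_nat p" "x \<in> A" "y \<in> A"
    and xy: "cong_in A (\<pi> ^ Suc m) x y"
  shows "cong_in A (\<pi> ^ (Suc m + k)) (x ^ (p ^ k)) (y ^ (p ^ k))"
proof (induction k)
  case (Suc k)
  let ?x = "x ^ (p ^ k)" and ?y = "y ^ (p ^ k)" and ?j = "Suc m + k"
  have in_A: "?x \<in> A" "?y \<in> A" using assms by (auto intro: subring_power)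
  obtain t where t: "t \<in> A" "?x - ?y = \<pi> ^ ?j * t" using Suc by (auto simp: cong_in_def)
  have "cong_in A (\<pi> ^ 1) ?x ?y"
    by (rule cong_in_power_le[OF A Suc]) (use assms in auto)
  then have 1: "cong_in A \<pi> ?x ?y" by simp
  have "cong_in A \<pi> (\<Sum>i<p. ?y ^ (p - Suc i) * ?x ^ i) (\<Sum>i<p. ?y ^ (p - Suc i) * ?y ^ i)"
    by (intro cong_in_sum cong_in_mult cong_in_power cong_in_refl 1 A in_A subring_power)
  also have "(\<Sum>i<p. ?y ^ (p - Suc i) * ?y ^ i) = (\<Sum>i<p. ?y ^ (p - 1))"
    by (intro sum.cong) (auto simp: power_add[symmetric])
  also have "\<dots> = of_nat p * ?y ^ (p - 1)" by simp
  finally have "cong_in A \<pi> (\<Sum>i<p. ?y ^ (p - Suc i) * ?x ^ i) (of_nat p * ?y ^ (p - 1))" .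
  then obtain u where u: "u \<in> A"
    "(\<Sum>i<p. ?y ^ (p - Suc i) * ?x ^ i) - of_nat p * ?y ^ (p - 1) = \<pi> * u"
    by (auto simp: cong_in_def)
  have "?x ^ p - ?y ^ p = (?x - ?y) * (\<Sum>i<p. ?y ^ (p - Suc i) * ?x ^ i)"
    by (rule power_diff_sumr2)
  also have "(\<Sum>i<p. ?y ^ (p - Suc i) * ?x ^ i) = \<pi> * (u + \<rho> * ?y ^ (p - 1))"
    using u(2) by (simp add: assms(4)[symmetric] algebra_simps)
  also have "(?x - ?y) * \<dots> = \<pi> ^ Suc ?j * (t * (u + \<rho> * ?y ^ (p - 1)))"
    by (simp add: t(2) algebra_simps)
  finally have "cong_in A (\<pi> ^ Suc ?j) (?x ^ p) (?y ^ p)"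
    by (rule cong_inI[rotated]) (intro subring_intros A t u assms)
  then show ?case by (simp add: power_mult[symmetric] mult.commute)
qed (use xy in simp)

section \<open>Homomorphisms between subrings\<close>

lemma ring_hom_onD:
  assumes "ring_hom_on A B f"
  shows "x \<in> A \<Longrightarrow> f x \<in> B" "f 1 = 1" "x \<in> A \<Longrightarrow> y \<in> A \<Longrightarrow> f (x + y) = f x + f y"
    "x \<in> A \<Longrightarrow> y \<in> A \<Longrightarrow> f (x * y) = f x * f y"
  using assms by (auto simp: ring_hom_on_def)

lemma ring_hom_on_zero:
  assumes "ring_hom_on A B f" "is_subring A"
  shows "f 0 = 0"
  using ring_hom_onD(3)[OF assms(1), of 0 0] subring_zero[OF assms(2)] by simp

lemma ring_hom_on_diff:
  assumes "ring_hom_on A B f" "is_subring A" "x \<in> A" "y \<in> A"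
  shows "f (x - y) = f x - f y"
  using ring_hom_onD(3)[OF assms(1), of "x - y" y] subring_diff[OF assms(2-4)] assms by simp

lemma ring_hom_on_power:
  assumes "ring_hom_on A B f" "is_subring A" "x \<in> A"
  shows "f (x ^ k) = f x ^ k"
  by (induction k) (use assms in \<open>auto simp: ring_hom_onD subring_power\<close>)

lemma ring_hom_on_of_nat:
  assumes "ring_hom_on A B f" "is_subring A"
  shows "f (of_nat k) = of_nat k"
  by (induction k) (use assms in \<open>auto simp: ring_hom_onD ring_hom_on_zero subring_intros\<close>)

lemma ring_hom_on_sum:
  assumes "ring_hom_on A B f" "is_subring A" "\<And>i. i \<in> I \<Longrightarrow> g i \<in> A"
  shows "f (sum g I) = (\<Sum>i\<in>I. f (g i))"
  using assms(3)
  by (induction I rule: infinite_finite_induct)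
    (use assms(1,2) in \<open>auto simp: ring_hom_on_zero ring_hom_onD subring_sum\<close>)

lemma ring_hom_on_cong:
  assumes f: "ring_hom_on A B f" and A: "is_subring A" and "x \<in> A" "y \<in> A" "m \<in> A"
    and xy: "cong_in A m x y"
  shows "cong_in B (f m) (f x) (f y)"
proof -
  obtain t where t: "t \<in> A" "x - y = m * t" using xy by (auto simp: cong_in_def)
  have "f x - f y = f m * f t"
    using ring_hom_on_diff[OF f A, of x y] ring_hom_onD(4)[OF f, of m t] t assms by simp
  then show ?thesis using t ring_hom_onD(1)[OF f] by (auto intro: cong_inI)
qed

section \<open>Integral elements\<close>

lemma polys_over_add:
  "is_subring A \<Longrightarrow> f \<in> polys_over A \<Longrightarrow> g \<in> polys_over A \<Longrightarrow> f + g \<in> polys_over A"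
  by (auto simp: polys_over_def intro: subring_add)

lemma polys_over_diff:
  "is_subring A \<Longrightarrow> f \<in> polys_over A \<Longrightarrow> g \<in> polys_over A \<Longrightarrow> f - g \<in> polys_over A"
  by (auto simp: polys_over_def intro: subring_diff)

lemma polys_over_mult:
  "is_subring A \<Longrightarrow> f \<in> polys_over A \<Longrightarrow> g \<in> polys_over A \<Longrightarrow> f * g \<in> polys_over A"
  by (auto simp: polys_over_def coeff_mult intro!: subring_sum subring_mult)

lemma polys_over_pCons:
  "a \<in> A \<Longrightarrow> f \<in> polys_over A \<Longrightarrow> pCons a f \<in> polys_over A"
  by (auto simp: polys_over_def coeff_pCons split: nat.split)

lemma polys_over_zero: "is_subring A \<Longrightarrow> 0 \<in> polys_over A"
  by (auto simp: polys_over_def intro: subring_zero)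

lemmas polys_over_intros = polys_over_add polys_over_diff polys_over_mult polys_over_pCons
  polys_over_zero

lemma ring_adjoinI: "f \<in> polys_over A \<Longrightarrow> poly f x = y \<Longrightarrow> y \<in> ring_adjoin A x"
  by (auto simp: ring_adjoin_def)

lemma ring_adjoin_const: "is_subring A \<Longrightarrow> a \<in> A \<Longrightarrow> a \<in> ring_adjoin A x"
  by (rule ring_adjoinI[of "[:a:]"]) (auto intro: polys_over_intros)

lemma ring_adjoin_self: "is_subring A \<Longrightarrow> x \<in> ring_adjoin A x"
  by (rule ring_adjoinI[of "[:0, 1:]"]) (auto intro: polys_over_intros subring_intros)

lemma ring_adjoin_subring:
  assumes A: "is_subring A"
  shows "is_subring (ring_adjoin A x)"
  unfolding is_subring_def
proof (intro conjI ballI)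
  show "1 \<in> ring_adjoin A x" by (intro ring_adjoin_const A subring_one)
next
  fix y z assume "y \<in> ring_adjoin A x" "z \<in> ring_adjoin A x"
  then obtain f g where fg: "f \<in> polys_over A" "poly f x = y" "g \<in> polys_over A" "poly g x = z"
    by (auto simp: ring_adjoin_def)
  show "y - z \<in> ring_adjoin A x"
    by (rule ring_adjoinI[of "f - g"]) (use A fg in \<open>auto intro: polys_over_intros\<close>)
  show "y * z \<in> ring_adjoin A x"
    by (rule ring_adjoinI[of "f * g"]) (use A fg in \<open>auto intro: polys_over_intros\<close>)
qed

lemma poly_in_subring:
  assumes B: "is_subring B" and "A \<subseteq> B" "x \<in> B" "f \<in> polys_over A"
  shows "poly f x \<in> B"
  unfolding poly_altdef
  by (rule subring_sum[OF B], rule subring_mult[OF B])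
    (use assms in \<open>auto simp: polys_over_def intro: subring_power\<close>)

lemma ring_adjoin_least:
  "is_subring B \<Longrightarrow> A \<subseteq> B \<Longrightarrow> x \<in> B \<Longrightarrow> ring_adjoin A x \<subseteq> B"
  by (auto simp: ring_adjoin_def intro: poly_in_subring)

lemma poly_monic_split:
  fixes f :: "'a::comm_ring_1 poly"
  assumes "lead_coeff f = 1"
  shows "poly f x = x ^ degree f + (\<Sum>i<degree f. coeff f i * x ^ i)"
  unfolding poly_altdef using assms by (simp add: lessThan_Suc_atMost[symmetric] add.commute)

text \<open>The monic equation rewrites \<open>x^k\<close> for k at least \<open>degree f\<close> as
  a combination of lower powers, so strong induction on k reaches the span of the powers below the
  degree.\<close>

lemma ring_adjoin_integral_span:
  fixes x :: "'a::comm_ring_1"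
  assumes A: "is_subring A" and f: "f \<in> polys_over A" "lead_coeff f = 1" "poly f x = 0"
    and y: "y \<in> ring_adjoin A x"
  shows "\<exists>a. (\<forall>i. a i \<in> A) \<and> y = (\<Sum>i<degree f. a i * x ^ i)"
proof -
  let ?d = "degree f"
  define S where "S = {\<Sum>i<?d. a i * x ^ i |a. \<forall>i. a i \<in> A}"
  have fin: "coeff f i \<in> A" for i using f(1) by (auto simp: polys_over_def)
  have add: "u + v \<in> S" if "u \<in> S" "v \<in> S" for u v
  proof -
    obtain a b where "\<forall>i. a i \<in> A" "\<forall>i. b i \<in> A"
      "u = (\<Sum>i<?d. a i * x ^ i)" "v = (\<Sum>i<?d. b i * x ^ i)"
      using \<open>u \<in> S\<close> \<open>v \<in> S\<close> by (auto simp: S_def)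
    then show ?thesis unfolding S_def
      by (intro CollectI exI[of _ "\<lambda>i. a i + b i"])
        (auto simp: sum.distrib algebra_simps intro: subring_add A)
  qed
  have scale: "c * u \<in> S" if "u \<in> S" "c \<in> A" for u c
  proof -
    obtain a where "\<forall>i. a i \<in> A" "u = (\<Sum>i<?d. a i * x ^ i)"
      using \<open>u \<in> S\<close> by (auto simp: S_def)
    then show ?thesis unfolding S_def using \<open>c \<in> A\<close>
      by (intro CollectI exI[of _ "\<lambda>i. c * a i"])
        (auto simp: sum_distrib_left mult.assoc intro: subring_mult A)
  qed
  have zero: "0 \<in> S"
    unfolding S_def by (intro CollectI exI[of _ "\<lambda>i. 0"]) (auto intro: subring_zero A)
  have sum: "sum g I \<in> S" if "\<And>i. i \<in> I \<Longrightarrow> g i \<in> S" for g and I :: "nat set"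
    using that by (induction I rule: infinite_finite_induct) (auto intro: add zero)
  have low: "x ^ k \<in> S" if "k < ?d" for k
    unfolding S_def using that
    by (intro CollectI exI[of _ "\<lambda>i. if i = k then 1 else 0"])
      (auto intro: subring_zero subring_one A simp: if_distrib[of "\<lambda>c. c * _"] cong: if_cong)
  have "x ^ k \<in> S" for k
  proof (induction k rule: less_induct)
    case (less k)
    show ?case
    proof (cases "k < ?d")
      case False
      have "x ^ ?d = - (\<Sum>i<?d. coeff f i * x ^ i)"
        using f(3) poly_monic_split[OF f(2), of x] by (simp add: add_eq_0_iff2)
      then have "x ^ (k - ?d) * x ^ ?d = (\<Sum>i<?d. - coeff f i * (x ^ (k - ?d) * x ^ i))"
        by (simp only:) (simp add: sum_distrib_left sum_negf algebra_simps)
      then have "x ^ k = (\<Sum>i<?d. - coeff f i * x ^ (k - ?d + i))"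
        using False by (simp only: power_add[symmetric]) simp
      also have "\<dots> \<in> S"
        by (intro sum scale less subring_uminus A fin) (use False in auto)
      finally show ?thesis .
    qed (rule low)
  qed
  moreover obtain g where "g \<in> polys_over A" "y = poly g x"
    using y by (auto simp: ring_adjoin_def)
  ultimately have "y \<in> S"
    unfolding poly_altdef by (auto intro!: sum scale simp: polys_over_def)
  then show ?thesis by (auto simp: S_def)
qed

text \<open>A determinant-free substitute for the Cayley-Hamilton argument: eliminating the last unknown
  by cross-multiplication keeps the diagonal monic of a common degree and the off-diagonal entries
  of smaller degree.\<close>

lemma monic_elimination:
  fixes y :: "'a::idom" and M :: "nat \<Rightarrow> nat \<Rightarrow> 'a poly" and D d :: nat
  assumes A: "is_subring A" and "D > 0"
    and "\<And>i j. i \<le> d \<Longrightarrow> j \<le> d \<Longrightarrow> M i j \<in> polys_over A"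
    and "\<And>i. i \<le> d \<Longrightarrow> degree (M i i) = D \<and> lead_coeff (M i i) = 1"
    and "\<And>i j. i \<le> d \<Longrightarrow> j \<le> d \<Longrightarrow> i \<noteq> j \<Longrightarrow> degree (M i j) < D"
    and "\<And>i. i \<le> d \<Longrightarrow> (\<Sum>j\<le>d. poly (M i j) y * v j) = 0"
  shows "\<exists>f\<in>polys_over A. lead_coeff f = 1 \<and> poly f y * v 0 = 0"
  using assms(2-)
proof (induction d arbitrary: M D)
  case 0
  then show ?case by (intro bexI[of _ "M 0 0"]) auto
next
  case (Suc d)
  let ?e = "Suc d"
  define N where "N = (\<lambda>i j. M ?e ?e * M i j - M i ?e * M ?e j)"
  have small: "degree (M i ?e * M ?e j) < D + D" if "i \<le> d" "j \<le> d" for i j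
    using degree_mult_le[of "M i ?e" "M ?e j"] Suc.prems(4)[of i ?e] Suc.prems(4)[of ?e j] that
    by linarith
  show ?case
  proof (rule Suc.IH[of "D + D" N])
    show "D + D > 0" using Suc.prems by simp
  next
    fix i j assume "i \<le> d" "j \<le> d"
    then show "N i j \<in> polys_over A"
      unfolding N_def by (intro polys_over_intros A Suc.prems) auto
  next
    fix i assume i: "i \<le> d"
    let ?u = "M ?e ?e * M i i" and ?w = "M i ?e * M ?e i"
    have nz: "M ?e ?e \<noteq> 0" "M i i \<noteq> 0" using Suc.prems(3)[of ?e] Suc.prems(3)[of i] i by auto
    have deg: "degree ?u = D + D"
      using nz Suc.prems(3)[of ?e] Suc.prems(3)[of i] i by (simp add: degree_mult_eq)
    have lead: "lead_coeff ?u = 1"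
      unfolding lead_coeff_mult using Suc.prems(3)[of ?e] Suc.prems(3)[of i] i
      by (metis le_Suc_eq mult_1 order_refl)
    have lt: "degree (- ?w) < degree ?u" using deg small[OF i i] by simp
    have "degree (?u + - ?w) = D + D" using degree_add_eq_left[OF lt] deg by simp
    moreover have "lead_coeff (?u + - ?w) = 1"
      using lead_coeff_add_le[of "- ?w" ?u] lt lead by (simp add: add.commute)
    ultimately show "degree (N i i) = D + D \<and> lead_coeff (N i i) = 1" by (simp add: N_def)
  next
    fix i j assume ij: "i \<le> d" "j \<le> d" "i \<noteq> j"
    have "degree (M ?e ?e * M i j) < D + D"
      using degree_mult_le[of "M ?e ?e" "M i j"] Suc.prems(3)[of ?e] Suc.prems(4)[of i j] ij
      by simp
    then show "degree (N i j) < D + D"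
      unfolding N_def using small[of i j] ij by (intro degree_diff_less) auto
  next
    fix i assume i: "i \<le> d"
    let ?m = "\<lambda>i j. poly (M i j) y"
    have 1: "(\<Sum>j\<le>d. ?m i j * v j) = - (?m i ?e * v ?e)"
      using Suc.prems(5)[of i] i by (simp add: eq_neg_iff_add_eq_0)
    have 2: "(\<Sum>j\<le>d. ?m ?e j * v j) = - (?m ?e ?e * v ?e)"
      using Suc.prems(5)[of ?e] by (simp add: eq_neg_iff_add_eq_0)
    have "(\<Sum>j\<le>d. poly (N i j) y * v j) =
        ?m ?e ?e * (\<Sum>j\<le>d. ?m i j * v j) - ?m i ?e * (\<Sum>j\<le>d. ?m ?e j * v j)"
      by (simp add: N_def sum_subtractf sum_distrib_left algebra_simps)
    also have "\<dots> = 0" by (simp only: 1 2) simp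
    finally show "(\<Sum>j\<le>d. poly (N i j) y * v j) = 0" .
  qed
qed

text \<open>Multiplication by y maps the span of 1, x, ..., \<open>x^d\<close> to itself. Its
  characteristic system has the vector of powers of x as a solution, and elimination yields a monic
  polynomial in y killing the entry \<open>x^0 = 1\<close>.\<close>

lemma ring_adjoin_integral:
  fixes x :: "'a::idom"
  assumes A: "is_subring A" and f: "f \<in> polys_over A" "lead_coeff f = 1" "poly f x = 0"
    and y: "y \<in> ring_adjoin A x"
  shows "\<exists>g\<in>polys_over A. lead_coeff g = 1 \<and> poly g y = 0"
proof -
  have "degree f \<noteq> 0"
  proof
    assume "degree f = 0"
    then obtain a where "f = [:a:]" by (rule degree_eq_zeroE)
    then show False using f by simp
  qed
  then obtain d where d: "degree f = Suc d" using not0_implies_Suc by blast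
  have "\<exists>a. (\<forall>j. a j \<in> A) \<and> y * x ^ i = (\<Sum>j<degree f. a j * x ^ j)" for i
    by (rule ring_adjoin_integral_span[OF A f])
      (intro subring_mult subring_power ring_adjoin_subring ring_adjoin_self A y)
  then have "\<forall>i. \<exists>a. (\<forall>j. a j \<in> A) \<and> y * x ^ i = (\<Sum>j\<le>d. a j * x ^ j)"
    by (simp add: d lessThan_Suc_atMost)
  then obtain a where a: "\<And>i j. a i j \<in> A" "\<And>i. y * x ^ i = (\<Sum>j\<le>d. a i j * x ^ j)"
    by metis
  define M where "M = (\<lambda>i j. if i = j then [:- a i i, 1:] else [:- a i j:])"
  have "\<exists>g\<in>polys_over A. lead_coeff g = 1 \<and> poly g y * x ^ 0 = 0"
  proof (rule monic_elimination[OF A, where M = M and D = 1 and d = d])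
    fix i assume i: "i \<le> d"
    have "(\<Sum>j\<le>d. poly (M i j) y * x ^ j) =
        (\<Sum>j\<le>d. (if j = i then y * x ^ i else 0) - a i j * x ^ j)"
      by (intro sum.cong) (auto simp: M_def algebra_simps)
    also have "\<dots> = 0" using i by (simp add: sum_subtractf a(2))
    finally show "(\<Sum>j\<le>d. poly (M i j) y * x ^ j) = 0" .
  qed (auto simp: M_def intro!: polys_over_pCons polys_over_zero A a subring_one subring_uminus)
  then show ?thesis by simp
qed

text \<open>The monic equation of z is multiplied by \<open>w^d * z\<close>, where d is its degree.
  Since w inverts z, every power of z cancels and z becomes a polynomial in w.\<close>

lemma integral_inverse_in_adjoin:
  fixes w z :: "'a::idom"
  assumes A: "is_subring A" and f: "f \<in> polys_over A" "lead_coeff f = 1" "poly f z = 0"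
    and wz: "w * z = 1"
  shows "z \<in> ring_adjoin A w"
proof -
  let ?d = "degree f"
  have w: "w ^ k * z ^ k = 1" for k by (simp add: power_mult_distrib[symmetric] wz)
  have "z = w ^ ?d * z ^ ?d * z" by (simp add: w)
  also have "\<dots> = - (\<Sum>i<?d. coeff f i * z ^ i) * (w ^ ?d * z)"
    using f(3) poly_monic_split[OF f(2), of z] by (simp add: add_eq_0_iff2 algebra_simps)
  also have "\<dots> = (\<Sum>i<?d. - coeff f i * (z ^ i * w ^ ?d * z))"
    by (simp add: sum_distrib_right sum_distrib_left sum_negf algebra_simps)
  also have "\<dots> = (\<Sum>i<?d. - coeff f i * w ^ (?d - Suc i))"
  proof (intro sum.cong refl)
    fix i assume "i \<in> {..<?d}"
    then have "w ^ ?d = w ^ Suc i * w ^ (?d - Suc i)" using power_add[of w "Suc i" "?d - Suc i"] by simp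
    then have "z ^ i * w ^ ?d * z = w ^ Suc i * z ^ Suc i * w ^ (?d - Suc i)"
      by (simp add: algebra_simps)
    then show "- coeff f i * (z ^ i * w ^ ?d * z) = - coeff f i * w ^ (?d - Suc i)"
      by (simp only: w) simp
  qed
  also have "\<dots> \<in> ring_adjoin A w"
    using f(1) ring_adjoin_subring[OF A]
    by (intro subring_sum subring_mult subring_power ring_adjoin_self ring_adjoin_const
        subring_uminus A) (auto simp: polys_over_def)
  finally show ?thesis .
qed

text \<open>Pigeonhole: modulo P, an element of \<open>ring_adjoin A x\<close> is given by
  \<open>degree f\<close> coefficients taken from the finite set N. The exponents \<open>g\<close>
  are left open because both the plain powers and the \<open>p^k\<close>-th powers of an element are
  compared later.\<close>

lemma integral_powers_repeat_mod:
  fixes x :: "'a::comm_ring_1" and g :: "nat \<Rightarrow> nat"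
  assumes A: "is_subring A" and f: "f \<in> polys_over A" "lead_coeff f = 1" "poly f x = 0"
    and N: "finite N" "\<And>a. a \<in> A \<Longrightarrow> \<exists>n\<in>N. cong_in A P a n"
  shows "\<exists>a b. a < b \<and> cong_in (ring_adjoin A x) P (x ^ g a) (x ^ g b)"
proof -
  let ?B = "ring_adjoin A x" and ?d = "degree f"
  have B: "is_subring ?B" by (rule ring_adjoin_subring[OF A])
  have AB: "A \<subseteq> ?B" using ring_adjoin_const[OF A] by blast
  have "\<exists>n. n \<in> {..<?d} \<rightarrow>\<^sub>E N \<and> cong_in ?B P (x ^ g k) (\<Sum>i<?d. n i * x ^ i)" for k
  proof -
    obtain a where a: "\<forall>i. a i \<in> A" "x ^ g k = (\<Sum>i<?d. a i * x ^ i)"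
      using ring_adjoin_integral_span[OF A f, of "x ^ g k"] subring_power[OF B] ring_adjoin_self[OF A]
      by blast
    have "\<forall>i. \<exists>n. n \<in> N \<and> cong_in A P (a i) n" using N(2) a(1) by blast
    then obtain n where n: "\<And>i. n i \<in> N" "\<And>i. cong_in A P (a i) (n i)" by metis
    have "cong_in ?B P (\<Sum>i<?d. a i * x ^ i) (\<Sum>i<?d. restrict n {..<?d} i * x ^ i)"
      using n(2) a(1) AB
      by (intro cong_in_sum cong_in_mult cong_in_refl B subring_power ring_adjoin_self A)
        (auto intro: cong_in_mono)
    then show ?thesis using n(1) a(2) by (intro exI[of _ "restrict n {..<?d}"]) auto
  qed
  then obtain n where n: "\<And>k. n k \<in> {..<?d} \<rightarrow>\<^sub>E N"
    "\<And>k. cong_in ?B P (x ^ g k) (\<Sum>i<?d. n k i * x ^ i)" by metis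
  have "range n \<subseteq> {..<?d} \<rightarrow>\<^sub>E N" using n(1) by blast
  then have "finite (range n)" using N(1) finite_PiE[of "{..<?d}" "\<lambda>_. N"] finite_subset by blast
  then have "\<not> inj n" using finite_imageD infinite_UNIV_nat by blast
  then obtain a b where ab: "a < b" "n a = n b"
    unfolding inj_def by (metis linorder_neqE_nat)
  have "cong_in ?B P (x ^ g a) (x ^ g b)"
    using cong_in_trans[OF B n(2)[of a]] cong_in_sym[OF B n(2)[of b]] ab(2) by simp
  then show ?thesis using ab(1) by blast
qed

lemma ring_adjoin_mono:
  "x' \<in> ring_adjoin A x \<Longrightarrow> is_subring A \<Longrightarrow> ring_adjoin A x' \<subseteq> ring_adjoin A x"
  by (intro ring_adjoin_least ring_adjoin_subring) (auto intro: ring_adjoin_const)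

lemma Zp_residues:
  fixes Zp :: "'k::field_char_0 set"
  assumes "is_Zp p Zp" "p > 0"
  shows "is_subring Zp" "\<And>a. a \<in> Zp \<Longrightarrow> \<exists>n\<in>of_nat ` {..<p}. cong_in Zp (of_nat p) a n"
proof -
  have c: "is_padic_completion p \<int> id Zp" using assms(1) by (simp add: is_Zp_def)
  show sub: "is_subring Zp" using c by (simp add: is_padic_completion_def)
  fix a assume "a \<in> Zp"
  then obtain b where b: "b \<in> \<int>" "cong_in Zp (of_nat p ^ 1) a b"
    using c unfolding is_padic_completion_def by (metis id_apply)
  obtain z where z: "b = of_int z" using b(1) by (auto simp: Ints_def)
  define n where "n = nat (z mod int p)"
  have n: "int n = z mod int p" using assms(2) by (simp add: n_def)
  have "z = int p * (z div int p) + int n" by (simp add: n)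
  then have "b = of_int (int p * (z div int p) + int n)" using z by metis
  then have "b - of_nat n = of_nat p * of_int (z div int p)" by simp
  moreover have "(of_int i :: 'k) \<in> Zp" for i
    using c by (auto simp: is_padic_completion_def ring_hom_on_def image_subset_iff)
  ultimately have "cong_in Zp (of_nat p) b (of_nat n)" by (intro cong_inI)
  then have "cong_in Zp (of_nat p) a (of_nat n)" using b(2) cong_in_trans[OF sub] by auto
  moreover have "n < p" using assms(2) n by (metis of_nat_0_less_iff of_nat_less_iff pos_mod_bound)
  ultimately show "\<exists>n\<in>of_nat ` {..<p}. cong_in Zp (of_nat p) a n" by auto
qed

text \<open>The powers of \<open>\<pi>\<close> repeat modulo \<open>p\<close>, and \<open>1 - \<pi>\<^sup>k\<close> is a unit because \<open>\<pi>\<close> generates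
  the maximal ideal of a local ring.\<close>

lemma prime_element_power_dvd:
  fixes Zp E :: "'k::field_char_0 set"
  assumes Zp: "is_Zp p Zp" "p > 0" and E: "is_subfield E"
    and \<pi>: "prime_element (integral_closure Zp E) \<pi>"
  shows "\<exists>e. cong_in (ring_adjoin Zp \<pi>) (of_nat p) (\<pi> ^ e) 0"
proof -
  let ?O = "integral_closure Zp E" and ?B = "ring_adjoin Zp \<pi>"
  note sub = Zp_residues(1)[OF Zp]
  have E_sub: "is_subring E" using E by (simp add: is_subfield_def)
  have B: "is_subring ?B" by (rule ring_adjoin_subring[OF sub])
  have \<pi>_B: "\<pi> \<in> ?B" by (rule ring_adjoin_self[OF sub])
  have nonunits: "{x \<in> ?O. \<not> (\<exists>y\<in>?O. x * y = 1)} = {\<pi> * y |y. y \<in> ?O}" and \<pi>_O: "\<pi> \<in> ?O"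
    using \<pi> by (auto simp: prime_element_def)
  obtain f where f: "f \<in> polys_over Zp" "lead_coeff f = 1" "poly f \<pi> = 0"
    using \<pi>_O by (auto simp: integral_closure_def)
  have "1 \<in> ?O"
    using E_sub by (auto simp: integral_closure_def
        intro!: subring_one bexI[of _ "[:-1, 1:]"] polys_over_pCons polys_over_zero subring_uminus sub)
  then have "\<pi> * 1 \<in> {x \<in> ?O. \<not> (\<exists>y\<in>?O. x * y = 1)}" unfolding nonunits by blast
  then have \<pi>_nonunit: "\<pi> * y \<noteq> 1" if "y \<in> ?O" for y using that by auto
  obtain a b where ab: "a < b" "cong_in ?B (of_nat p) (\<pi> ^ a) (\<pi> ^ b)"
    using integral_powers_repeat_mod[OF sub f, of "of_nat ` {..<p}" "of_nat p" "\<lambda>k. k"]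
      Zp_residues(2)[OF Zp] by auto
  define w where "w = 1 - \<pi> ^ (b - a)"
  have w_B: "w \<in> ?B" unfolding w_def by (intro subring_intros B \<pi>_B)
  have "w \<in> ?O"
    using ring_adjoin_integral[OF sub f w_B] \<pi>_O E_sub
    by (auto simp: integral_closure_def w_def intro: subring_intros)
  \<comment> \<open>The shortcut \<open>1 = \<pi> * (y + \<pi>^k)\<close> would need integrality of
    a sum of two unrelated integral elements, whereas \<open>ring_adjoin_integral\<close> covers
    only \<open>Zp[\<pi>]\<close>. Instead the equation of y, scaled by \<open>\<pi>^m * u\<close>
    with u the inverse of \<pi>, puts \<open>w^m * u\<close> into \<open>Zp[\<pi>]\<close>. As
    \<open>w^m = 1 + \<pi> * t\<close>, also u lies there and is integral, contradicting that \<pi>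
    is not a unit.\<close>
  moreover have "w \<noteq> \<pi> * y" if "y \<in> ?O" for y
  proof
    assume eq: "w = \<pi> * y"
    obtain g where g: "g \<in> polys_over Zp" "lead_coeff g = 1" "poly g y = 0"
      using \<open>y \<in> ?O\<close> by (auto simp: integral_closure_def)
    define m where "m = degree g"
    define u where "u = inverse \<pi>"
    have u: "\<pi> * u = 1" using \<pi> by (simp add: u_def prime_element_def)
    obtain k where k: "b - a = Suc k" using ab(1) by (metis Suc_diff_Suc)
    have "cong_in ?B \<pi> w 1"
      by (rule cong_inI[of "- (\<pi> ^ k)"])
        (auto simp: w_def k intro: subring_uminus subring_power B \<pi>_B)
    then have "cong_in ?B \<pi> (w ^ m) (1 ^ m)"
      by (intro cong_in_power B w_B subring_one)
    then obtain t where t: "t \<in> ?B" "w ^ m - 1 = \<pi> * t" by (auto simp: cong_in_def)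
    have "y ^ m = - (\<Sum>i<m. coeff g i * y ^ i)"
      using g(3) poly_monic_split[OF g(2), of y] by (simp add: add_eq_0_iff2 m_def)
    then have "w ^ m * u = - (\<Sum>i<m. coeff g i * y ^ i) * (\<pi> ^ m * u)"
      by (simp add: eq power_mult_distrib algebra_simps)
    also have "\<dots> = (\<Sum>i<m. - coeff g i * (y ^ i * (\<pi> ^ m * u)))"
      by (simp add: sum_distrib_left sum_negf algebra_simps)
    also have "\<dots> = (\<Sum>i<m. - coeff g i * (w ^ i * \<pi> ^ (m - Suc i)))"
    proof (intro sum.cong refl)
      fix i assume "i \<in> {..<m}"
      then have "\<pi> ^ m = \<pi> ^ i * (\<pi> * \<pi> ^ (m - Suc i))"
        using power_add[of \<pi> "Suc i" "m - Suc i"] by (simp add: algebra_simps)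
      then have "y ^ i * (\<pi> ^ m * u) = (\<pi> * y) ^ i * \<pi> ^ (m - Suc i) * (\<pi> * u)"
        by (simp add: power_mult_distrib algebra_simps)
      then show "- coeff g i * (y ^ i * (\<pi> ^ m * u)) = - coeff g i * (w ^ i * \<pi> ^ (m - Suc i))"
        by (simp add: u eq)
    qed
    also have "\<dots> \<in> ?B"
      using g(1) by (intro subring_sum subring_mult subring_power subring_uminus
          ring_adjoin_const[OF sub] B w_B \<pi>_B) (auto simp: polys_over_def)
    finally have "w ^ m * u - t \<in> ?B" using t by (intro subring_diff B)
    moreover have "w ^ m * u - t = u + t * (\<pi> * u - 1)"
      using t(2) by (simp add: algebra_simps diff_eq_eq)
    ultimately have "u \<in> ?B" by (simp add: u)
    then have "u \<in> ?O"
      using ring_adjoin_integral[OF sub f] \<pi>_O E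
      by (auto simp: integral_closure_def u_def is_subfield_def)
    then show False using \<pi>_nonunit u by blast
  qed
  ultimately obtain z where z: "z \<in> ?O" "w * z = 1" using nonunits by blast
  obtain g where g: "g \<in> polys_over Zp" "lead_coeff g = 1" "poly g z = 0"
    using z(1) by (auto simp: integral_closure_def)
  \<comment> \<open>The divisibility is claimed in \<open>Zp[\<pi>]\<close>, so the inverse of w
    must lie in that ring and not merely in the integral closure.\<close>
  have z_B: "z \<in> ?B"
    using integral_inverse_in_adjoin[OF sub g z(2)] ring_adjoin_mono[OF w_B sub] by blast
  obtain t where t: "t \<in> ?B" "\<pi> ^ a - \<pi> ^ b = of_nat p * t" using ab(2) by (auto simp: cong_in_def)
  have "\<pi> ^ b = \<pi> ^ a * \<pi> ^ (b - a)" using ab(1) by (simp add: power_add[symmetric])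
  then have "\<pi> ^ a * w = of_nat p * t" using t(2) by (simp add: w_def algebra_simps)
  then have "\<pi> ^ a * (w * z) = of_nat p * (t * z)" by (metis mult.assoc)
  then have "\<pi> ^ a - 0 = of_nat p * (t * z)" by (simp add: z(2))
  then show ?thesis by (intro exI[of _ a] cong_inI[of "t * z"] subring_mult B t z_B)
qed

section \<open>Complete discrete valuation rings with perfect residue field\<close>

text \<open>These are the properties of the Witt vectors of a perfect field:
  \<open>unit_or_cong\<close> and \<open>one_not_cong\<close> make \<open>p\<close> generate the
  maximal ideal, and \<open>perfect\<close> states perfectness of the residue field by
  representatives.\<close>

locale strict_p_ring =
  fixes p :: nat and R :: "'k::field_char_0 set"
  assumes p: "prime p"
    and R: "is_subring R"
    and complete: "padically_complete p R"
    and unit_or_cong: "\<And>x. x \<in> R \<Longrightarrow> (\<exists>y\<in>R. x * y = 1) \<or> cong_in R (of_nat p) x 0"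
    and one_not_cong: "\<not> cong_in R (of_nat p) 1 0"
    and perfect: "\<And>x. x \<in> R \<Longrightarrow> \<exists>y\<in>R. cong_in R (of_nat p) x (y ^ p)"
begin

abbreviation P :: 'k where "P \<equiv> of_nat p"

lemma P_in: "P \<in> R"
  by (rule subring_of_nat[OF R])

lemma P_nonzero: "P \<noteq> 0"
  using p by (simp add: prime_gt_0_nat)

lemma eq_if_cong_all:
  assumes "x \<in> R" "y \<in> R" "\<And>m. cong_in R (P ^ m) x y"
  shows "x = y"
proof -
  have "x - y \<in> R" using assms R by (auto intro: subring_diff)
  moreover have "\<forall>m. cong_in R (P ^ m) (x - y) 0"
    using assms(3) by (simp add: cong_in_def)
  ultimately have "x - y = 0" using complete by (auto simp: padically_complete_def)
  then show ?thesis by simp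
qed

lemma cauchy_limit:
  assumes "\<And>m. u m \<in> R" "\<And>m. cong_in R (P ^ m) (u (Suc m)) (u m)"
  obtains x where "x \<in> R" "\<And>m. cong_in R (P ^ m) x (u m)"
proof -
  have "(\<forall>m. u m \<in> R) \<and> (\<forall>m. cong_in R (P ^ m) (u (Suc m)) (u m)) \<longrightarrow>
      (\<exists>x\<in>R. \<forall>m. cong_in R (P ^ m) x (u m))"
    using complete unfolding padically_complete_def by simp
  then show thesis using assms that by blast
qed

lemma not_cong_imp_unit:
  assumes "x \<in> R" "\<not> cong_in R P x 0"
  shows "inverse x \<in> R" "x \<noteq> 0"
proof -
  obtain y where y: "y \<in> R" "x * y = 1" using unit_or_cong assms by blast
  then show "x \<noteq> 0" by auto
  then show "inverse x \<in> R" using y inverse_unique[of x y] by simp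
qed

lemma power_cong_zero:
  assumes "x \<in> R" "cong_in R P (x ^ k) 0"
  shows "cong_in R P x 0"
proof (rule ccontr)
  assume n: "\<not> cong_in R P x 0"
  obtain y where y: "y \<in> R" "x * y = 1" using unit_or_cong assms(1) n by blast
  have "cong_in R P (x ^ k * y ^ k) (0 * y ^ k)"
    using assms y R by (intro cong_in_mult cong_in_refl subring_power)
  then show False using one_not_cong y(2) by (simp add: power_mult_distrib[symmetric])
qed

lemma perfect_power: "x \<in> R \<Longrightarrow> \<exists>y\<in>R. cong_in R P x (y ^ (p ^ k))"
proof (induction k arbitrary: x)
  case 0
  then show ?case by (intro bexI[of _ x]) (auto intro: cong_in_refl R)
next
  case (Suc k)
  obtain y where y: "y \<in> R" "cong_in R P x (y ^ p)" using perfect Suc.prems by blast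
  obtain z where z: "z \<in> R" "cong_in R P y (z ^ (p ^ k))" using Suc.IH y(1) by blast
  have "cong_in R P (y ^ p) ((z ^ (p ^ k)) ^ p)"
    using y z R by (intro cong_in_power subring_power)
  then show ?case
    using z(1) cong_in_trans[OF R y(2)]
    by (intro bexI[of _ z]) (auto simp: power_mult[symmetric] mult.commute)
qed

text \<open>The case of uniformizer P with cofactor 1. The s factors gained are cut down to one,
  which is all that the contraction uses.\<close>

lemma cong_in_power_Suc:
  assumes "x \<in> R" "y \<in> R" "cong_in R (P ^ Suc m) x y" "s \<ge> 1"
  shows "cong_in R (P ^ Suc (Suc m)) (x ^ (p ^ s)) (y ^ (p ^ s))"
proof -
  have "cong_in R (P ^ (Suc m + s)) (x ^ (p ^ s)) (y ^ (p ^ s))"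
    by (rule cong_in_prime_power_raise[OF R P_in subring_one[OF R]]) (use assms in auto)
  then show ?thesis
    by (rule cong_in_power_le[OF R _ P_in]) (use assms in auto)
qed

text \<open>Two homomorphisms that agree modulo \<open>\<pi>\<close> agree modulo \<open>\<pi>\<^sup>k\<close> for all \<open>k\<close>: every element is
  a \<open>p\<^sup>k\<close>-th power modulo \<open>p\<close>, and \<open>p\<^sup>k\<close>-th powers improve the congruence.\<close>

lemma ring_hom_cong_all:
  fixes f g :: "'k \<Rightarrow> 'k"
  assumes B: "is_subring B" "\<pi> \<in> B" "\<rho> \<in> B" "\<pi> * \<rho> = P"
    and f: "ring_hom_on R B f" and g: "ring_hom_on R B g"
    and fg: "\<And>a. a \<in> R \<Longrightarrow> cong_in B \<pi> (f a) (g a)" and a: "a \<in> R"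
  shows "cong_in B (\<pi> ^ k) (f a) (g a)"
  using a
proof (induction k arbitrary: a)
  case 0
  then have "f a - g a \<in> B" using ring_hom_onD(1)[OF f] ring_hom_onD(1)[OF g] B by (auto intro: subring_diff)
  then show ?case by (auto intro: cong_inI)
next
  case (Suc k)
  \<comment> \<open>The \<open>p^k\<close>-th power of b gains k factors of \<pi> over the
    congruence modulo \<pi>. The remainder \<open>P * c\<close> gains one factor over the induction
    hypothesis for c, because \<open>P = \<pi> * \<rho>\<close>.\<close>
  obtain b where b: "b \<in> R" "cong_in R P a (b ^ (p ^ k))" using perfect_power Suc.prems by blast
  then obtain c where c: "c \<in> R" "a - b ^ (p ^ k) = P * c" by (auto simp: cong_in_def)
  have eq: "a = b ^ (p ^ k) + P * c" using c(2) by (simp add: algebra_simps)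
  have hom: "F a = F b ^ (p ^ k) + P * F c" if "ring_hom_on R B F" for F :: "'k \<Rightarrow> 'k"
    unfolding eq using b c R P_in
    by (simp add: ring_hom_onD[OF that] ring_hom_on_power[OF that] ring_hom_on_of_nat[OF that]
        subring_power subring_mult)
  have "cong_in B (\<pi> ^ (Suc 0 + k)) (f b ^ (p ^ k)) (g b ^ (p ^ k))"
    by (rule cong_in_prime_power_raise[OF B])
      (use fg[OF b(1)] ring_hom_onD(1)[OF f b(1)] ring_hom_onD(1)[OF g b(1)] in auto)
  moreover have "cong_in B (\<pi> ^ Suc k) (P * f c) (P * g c)"
  proof -
    have "cong_in B (P * \<pi> ^ k) (P * f c) (P * g c)" by (intro cong_in_scale Suc.IH c)
    then have "cong_in B (\<pi> ^ Suc k * \<rho>) (P * f c) (P * g c)"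
      by (simp add: B(4)[symmetric] algebra_simps)
    then show ?thesis by (rule cong_in_dvd_modulus[OF B(1) _ B(3)])
  qed
  ultimately show ?case unfolding hom[OF f] hom[OF g] using cong_in_add[OF B(1)] by simp
qed

end

section \<open>Powers of the Frobenius lift and their inverses\<close>

locale frobenius_power = strict_p_ring p R for p and R :: "'k::field_char_0 set" +
  fixes \<sigma> :: "'k \<Rightarrow> 'k" and s :: nat
  assumes hom: "ring_hom_on R R \<sigma>"
    and frob: "\<And>a. a \<in> R \<Longrightarrow> cong_in R P (\<sigma> a) (a ^ (p ^ s))"
    and s: "s \<ge> 1"
begin

lemma \<sigma>_in: "a \<in> R \<Longrightarrow> \<sigma> a \<in> R"
  using ring_hom_onD(1)[OF hom] .

lemma \<sigma>_cong:
  assumes "x \<in> R" "y \<in> R" "cong_in R (P ^ m) x y"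
  shows "cong_in R (P ^ m) (\<sigma> x) (\<sigma> y)"
  using ring_hom_on_cong[OF hom R assms(1,2) subring_power[OF R P_in] assms(3)]
  by (simp add: ring_hom_on_power[OF hom R P_in] ring_hom_on_of_nat[OF hom R])

text \<open>\<sigma> fixes P, so factors of P can be split off one at a time. For the remaining
  cofactor y, \<open>\<sigma> y\<close> is congruent to a power of y modulo P, and modulo P there
  are no nilpotents.\<close>

lemma \<sigma>_cong_zero: "x \<in> R \<Longrightarrow> cong_in R (P ^ m) (\<sigma> x) 0 \<Longrightarrow> cong_in R (P ^ m) x 0"
proof (induction m)
  case 0
  then show ?case by (auto intro: cong_inI[of x])
next
  case (Suc m)
  have "cong_in R (P ^ m) (\<sigma> x) 0"
    by (rule cong_in_power_le[OF R Suc.prems(2) P_in]) simp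
  then obtain y where y: "y \<in> R" "x = P ^ m * y" using Suc by (auto simp: cong_in_def)
  obtain t where t: "t \<in> R" "\<sigma> x = P ^ Suc m * t" using Suc.prems by (auto simp: cong_in_def)
  have "\<sigma> x = P ^ m * \<sigma> y"
    unfolding y(2) using y(1) R P_in
    by (simp add: ring_hom_onD[OF hom] ring_hom_on_power[OF hom] ring_hom_on_of_nat[OF hom]
        subring_power)
  then have "\<sigma> y = P * t" using t(2) P_nonzero by simp
  then have "cong_in R P (\<sigma> y) 0" using t(1) by (auto intro: cong_inI)
  then have "cong_in R P (y ^ (p ^ s)) 0"
    using cong_in_trans[OF R cong_in_sym[OF R frob[OF y(1)]]] by blast
  then obtain z where "z \<in> R" "y = P * z" using power_cong_zero[OF y(1)] by (auto simp: cong_in_def)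
  then show ?case by (auto simp: y(2) intro!: cong_inI[of z])
qed

lemma \<sigma>_cong_iff:
  assumes "x \<in> R" "y \<in> R"
  shows "cong_in R (P ^ m) (\<sigma> x) (\<sigma> y) \<longleftrightarrow> cong_in R (P ^ m) x y"
  using \<sigma>_cong_zero[of "x - y" m] \<sigma>_cong[OF assms] assms R
  by (auto simp: cong_in_def ring_hom_on_diff[OF hom R] intro: subring_diff)

text \<open>Perfectness makes \<sigma> surjective modulo P, giving
  \<open>b = \<sigma> (g b) + P * e b\<close>. Iterating on the remainders \<open>r m\<close>
  produces the digits of a P-adic series whose image is a.\<close>

lemma \<sigma>_surj:
  assumes a: "a \<in> R"
  shows "\<exists>x\<in>R. \<sigma> x = a"
proof -
  have "\<exists>y z. y \<in> R \<and> z \<in> R \<and> b = \<sigma> y + P * z" if b: "b \<in> R" for b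
  proof -
    obtain y where y: "y \<in> R" "cong_in R P b (y ^ (p ^ s))" using perfect_power[OF b] by blast
    then have "cong_in R P b (\<sigma> y)" using cong_in_trans[OF R] cong_in_sym[OF R frob] by blast
    then show ?thesis using y(1) by (auto simp: cong_in_def diff_eq_eq algebra_simps)
  qed
  then obtain g e where ge: "\<And>b. b \<in> R \<Longrightarrow> g b \<in> R" "\<And>b. b \<in> R \<Longrightarrow> e b \<in> R"
    "\<And>b. b \<in> R \<Longrightarrow> b = \<sigma> (g b) + P * e b" by metis
  define r where "r = (\<lambda>m. (e ^^ m) a)"
  have r: "r m \<in> R" for m unfolding r_def by (induction m) (auto simp: a ge)
  define u where "u = (\<lambda>m. \<Sum>i<m. P ^ i * g (r i))"
  have u: "u m \<in> R" for m
    unfolding u_def by (intro subring_sum subring_mult subring_power R P_in ge r)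
  have step: "u (Suc m) = u m + P ^ m * g (r m)" for m by (simp add: u_def)
  have \<sigma>u: "a - \<sigma> (u m) = P ^ m * r m" for m
  proof (induction m)
    case 0
    then show ?case using ring_hom_on_zero[OF hom R] by (simp add: u_def r_def)
  next
    case (Suc m)
    have "\<sigma> (u (Suc m)) = \<sigma> (u m) + P ^ m * \<sigma> (g (r m))"
      unfolding step using u r ge R P_in
      by (simp add: ring_hom_onD[OF hom] ring_hom_on_power[OF hom] ring_hom_on_of_nat[OF hom]
          subring_power subring_mult)
    moreover have "r m = \<sigma> (g (r m)) + P * r (Suc m)" using ge(3)[OF r[of m]] by (simp add: r_def)
    then have "P ^ m * r m = P ^ m * \<sigma> (g (r m)) + P ^ Suc m * r (Suc m)"
      by (metis distrib_left mult.assoc power_Suc2)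
    ultimately show ?case using Suc by (simp add: algebra_simps)
  qed
  obtain x where x: "x \<in> R" "\<And>m. cong_in R (P ^ m) x (u m)"
    by (rule cauchy_limit[of u]) (auto simp: step u intro!: cong_inI[of "g (r _)"] ge r)
  have "cong_in R (P ^ m) (\<sigma> x) a" for m
  proof -
    have "cong_in R (P ^ m) a (\<sigma> (u m))" using \<sigma>u r by (intro cong_inI)
    then show ?thesis
      using \<sigma>_cong[OF x(1) u x(2)] cong_in_trans[OF R] cong_in_sym[OF R] by blast
  qed
  then have "\<sigma> x = a" by (intro eq_if_cong_all \<sigma>_in x a)
  then show ?thesis using x(1) by blast
qed

lemma \<sigma>_inj: "x \<in> R \<Longrightarrow> y \<in> R \<Longrightarrow> \<sigma> x = \<sigma> y \<Longrightarrow> x = y"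
  by (rule eq_if_cong_all) (simp_all add: \<sigma>_cong_iff[symmetric] cong_in_refl[OF R])

definition \<tau> :: "'k \<Rightarrow> 'k" where "\<tau> = inv_into R \<sigma>"

lemma \<tau>: "a \<in> R \<Longrightarrow> \<tau> a \<in> R" "a \<in> R \<Longrightarrow> \<sigma> (\<tau> a) = a"
  using \<sigma>_surj[of a] unfolding \<tau>_def by (auto intro: inv_into_into f_inv_into_f)

lemma \<tau>_eq_iff: "a \<in> R \<Longrightarrow> x \<in> R \<Longrightarrow> \<tau> a = x \<longleftrightarrow> \<sigma> x = a"
  using \<tau> \<sigma>_inj by metis

lemma \<tau>_cong:
  assumes "x \<in> R" "y \<in> R" "cong_in R (P ^ m) x y"
  shows "cong_in R (P ^ m) (\<tau> x) (\<tau> y)"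
  using \<sigma>_cong_iff[of "\<tau> x" "\<tau> y" m] assms \<tau> by simp

end

section \<open>Fixed points of p-adic contractions\<close>

context strict_p_ring
begin

text \<open>Banach's argument on a residue class. Any two points of X agree modulo P; this starts
  both the Cauchy estimate for the iterates and the comparison of two fixed points.\<close>

lemma contraction_fixed_point:
  fixes T :: "('i \<Rightarrow> 'k) \<Rightarrow> 'i \<Rightarrow> 'k" and w0 :: "'i \<Rightarrow> 'k"
  defines "X \<equiv> {w. \<forall>i. w i \<in> R \<and> cong_in R P (w i) (w0 i)}"
  assumes w0: "\<And>i. w0 i \<in> R"
    and T: "\<And>w. w \<in> X \<Longrightarrow> T w \<in> X"
    and contr: "\<And>w w' m i. w \<in> X \<Longrightarrow> w' \<in> X \<Longrightarrow> (\<And>i. cong_in R (P ^ Suc m) (w i) (w' i)) \<Longrightarrow>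
      cong_in R (P ^ Suc (Suc m)) (T w i) (T w' i)"
  shows "\<exists>!w. w \<in> X \<and> T w = w"
proof -
  have X_cong: "cong_in R P (w i) (w' i)" if "w \<in> X" "w' \<in> X" for w w' i
    using that cong_in_trans[OF R _ cong_in_sym[OF R]] unfolding X_def by blast
  have X_in: "w i \<in> R" if "w \<in> X" for w i using that by (simp add: X_def)
  define u where "u = (\<lambda>m. (T ^^ m) w0)"
  have "w0 \<in> X" unfolding X_def using w0 by (auto intro: cong_in_refl R)
  then have u_X: "u m \<in> X" for m
    unfolding u_def by (induction m) (auto intro: T)
  have u_Suc: "u (Suc m) = T (u m)" for m by (simp add: u_def)
  have cauchy: "cong_in R (P ^ Suc m) (u (Suc m) i) (u m i)" for m i
  proof (induction m arbitrary: i)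
    case 0
    then show ?case using X_cong[OF u_X u_X] by simp
  next
    case (Suc m)
    have "cong_in R (P ^ Suc (Suc m)) (T (u (Suc m)) i) (T (u m) i)"
      by (intro contr u_X Suc)
    then show ?case by (simp only: u_Suc)
  qed
  have "\<exists>x. x \<in> R \<and> (\<forall>m. cong_in R (P ^ m) x (u m i))" for i
  proof (rule cauchy_limit[of "\<lambda>m. u m i"])
    show "cong_in R (P ^ m) (u (Suc m) i) (u m i)" for m
      by (rule cong_in_power_le[OF R cauchy P_in]) simp
  qed (use X_in[OF u_X] in blast)+
  then obtain w where w: "\<And>i. w i \<in> R" "\<And>i m. cong_in R (P ^ m) (w i) (u m i)" by metis
  have w_X: "w \<in> X"
    using w(1) w(2)[of 1] u_X[of 1] cong_in_trans[OF R] unfolding X_def by fastforce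
  have "T w i = w i" for i
  proof (rule eq_if_cong_all)
    fix m
    have "cong_in R (P ^ Suc (Suc m)) (T w i) (T (u (Suc m)) i)"
      by (intro contr w_X u_X w)
    then have "cong_in R (P ^ m) (T w i) (u (Suc (Suc m)) i)"
      unfolding u_Suc[of "Suc m"] by (rule cong_in_power_le[OF R _ P_in]) simp
    moreover have "cong_in R (P ^ m) (w i) (u (Suc (Suc m)) i)"
      by (rule cong_in_power_le[OF R w(2) P_in]) simp
    ultimately show "cong_in R (P ^ m) (T w i) (w i)"
      using cong_in_trans[OF R] cong_in_sym[OF R] by blast
  qed (use X_in[OF w_X] X_in[OF T[OF w_X]] in auto)
  then have "w \<in> X \<and> T w = w" using w_X by blast
  moreover have "w = w'" if fp: "w \<in> X" "T w = w" "w' \<in> X" "T w' = w'" for w w'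
  proof
    fix i
    have fp_cong: "cong_in R (P ^ Suc m) (w j) (w' j)" for m j
    proof (induction m arbitrary: j)
      case 0
      then show ?case using X_cong fp by simp
    next
      case (Suc m)
      then show ?case using contr[OF fp(1,3), of m j] fp(2,4) by simp
    qed
    have "cong_in R (P ^ m) (w i) (w' i)" for m
      by (rule cong_in_power_le[OF R fp_cong[of m] P_in]) simp
    then show "w i = w' i" by (intro eq_if_cong_all X_in fp)
  qed
  ultimately show ?thesis by blast
qed

end

section \<open>The completed ring of integers satisfies the axioms\<close>

lemma integral_closure_base:
  assumes "is_subring A" "A \<subseteq> L"
  shows "A \<subseteq> integral_closure A L"
proof
  fix a assume "a \<in> A"
  then show "a \<in> integral_closure A L"
    using assms by (auto simp: integral_closure_def intro!: bexI[of _ "[:- a, 1:]"]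
        polys_over_pCons polys_over_zero subring_uminus subring_one)
qed

text \<open>Writing \<open>x * y = 1 - P * t\<close>, the geometric series in \<open>P * t\<close>
  converges and inverts \<open>x * y\<close>.\<close>

lemma complete_unit_if_cong_unit:
  fixes R :: "'k::field_char_0 set"
  assumes R: "is_subring R" and compl: "padically_complete p R"
    and x: "x \<in> R" and y: "y \<in> R" and xy: "cong_in R (of_nat p) (x * y) 1"
  shows "\<exists>z\<in>R. x * z = 1"
proof -
  let ?P = "of_nat p :: 'k"
  have P: "?P \<in> R" by (rule subring_of_nat[OF R])
  obtain t where t: "t \<in> R" "1 - x * y = ?P * t"
    using cong_in_sym[OF R xy] by (auto simp: cong_in_def)
  define u where "u = (\<lambda>m. \<Sum>i<m. (?P * t) ^ i)"
  have u: "u m \<in> R" for m unfolding u_def by (intro subring_intros R t)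
  have "(\<forall>m. u m \<in> R) \<and> (\<forall>m. cong_in R (?P ^ m) (u (Suc m)) (u m)) \<longrightarrow>
      (\<exists>z\<in>R. \<forall>m. cong_in R (?P ^ m) z (u m))"
    using compl unfolding padically_complete_def by simp
  moreover have "cong_in R (?P ^ m) (u (Suc m)) (u m)" for m
    by (rule cong_inI[of "t ^ m"]) (auto simp: u_def power_mult_distrib intro: subring_power R t)
  ultimately obtain z where z: "z \<in> R" "\<And>m. cong_in R (?P ^ m) z (u m)" using u by blast
  have "cong_in R (?P ^ m) (x * y * z - 1) 0" for m
  proof -
    have "cong_in R (?P ^ m) (x * y * z) (x * y * u m)"
      by (intro cong_in_mult cong_in_refl subring_intros R x y z u)
    moreover have "x * y * u m = 1 - (?P * t) ^ m"
    proof -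
      have "x * y = 1 - ?P * t" using t(2) by (simp add: algebra_simps)
      then show ?thesis unfolding u_def by (simp add: one_diff_power_eq)
    qed
    then have "cong_in R (?P ^ m) (x * y * u m) 1"
      using t(1) by (intro cong_inI[of "- (t ^ m)"])
        (auto simp: power_mult_distrib intro: subring_intros R)
    ultimately show ?thesis using cong_in_trans[OF R] by (fastforce simp: cong_in_def)
  qed
  moreover have "x * y * z - 1 \<in> R" by (intro subring_intros R x y z)
  ultimately have "x * y * z - 1 = 0" using compl by (auto simp: padically_complete_def)
  then have "x * (y * z) = 1" by (simp add: mult.assoc)
  then show ?thesis using y z by (auto intro: subring_mult R)
qed

text \<open>Applying \<open>C_poly\<close> to x - y and y, whose sum is x, avoids the sign of a
  power of -y.\<close>

lemma power_diff_cong: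
  fixes x y :: "'a::comm_ring_1"
  assumes A: "is_subring A" and "prime p" "x \<in> A" "y \<in> A"
  shows "cong_in A (of_nat p) ((x - y) ^ (p ^ k)) (x ^ (p ^ k) - y ^ (p ^ k))"
proof (rule cong_inI)
  show "C_poly p k (x - y) y \<in> A"
    unfolding C_poly_def by (intro subring_intros assms)
  show "(x - y) ^ p ^ k - (x ^ p ^ k - y ^ p ^ k) = of_nat p * C_poly p k (x - y) y"
    by (simp add: C_poly_eq[OF assms(2)])
qed

text \<open>Each integer of M lies in a finite unramified L, whose integers have \<open>p\<close> as
  a prime element; this settles the axioms for \<open>OM\<close>. They pass to \<open>R\<close>
  because every element of \<open>R\<close> is congruent modulo \<open>p\<close> to one of
  \<open>OM\<close>, and completeness lifts units from residues.\<close>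

lemma completed_Zp_ur_strict_p_ring:
  fixes Zp R :: "'k::{alg_closed_field,field_char_0} set"
  assumes p: "prime p" and Zp: "is_Zp p Zp" and R: "is_completed_Zp_ur p Zp R"
  shows "strict_p_ring p R" "Zp \<subseteq> R"
proof -
  let ?P = "of_nat p :: 'k"
  have p0: "p > 0" using p by (simp add: prime_gt_0_nat)
  obtain M where M: "maximal_unramified p Zp M"
    and c: "is_padic_completion p (integral_closure Zp M) id R"
    using R by (auto simp: is_completed_Zp_ur_def)
  define OM where "OM = integral_closure Zp M"
  have OM: "is_subring OM" and R: "is_subring R" and compl: "padically_complete p R" and OR: "OM \<subseteq> R"
    and approx: "\<And>m x. x \<in> R \<Longrightarrow> \<exists>b\<in>OM. cong_in R (?P ^ m) x b"
    and inj: "\<And>m b. b \<in> OM \<Longrightarrow> cong_in R (?P ^ m) b 0 \<Longrightarrow> cong_in OM (?P ^ m) b 0"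
    using c by (auto simp: is_padic_completion_def OM_def ring_hom_on_def)
  have M_ur: "\<exists>L. finite_unramified p Zp L \<and> x \<in> L \<and> L \<subseteq> M" if "x \<in> M" for x
    using M that by (auto simp: maximal_unramified_def unramified_def)
  have L_props: "is_subring L" "Zp \<subseteq> L" "prime_element (integral_closure Zp L) ?P"
    if "finite_unramified p Zp L" for L
  proof -
    have "extension_degree (fraction_field Zp) L n \<Longrightarrow> is_subring L \<and> fraction_field Zp \<subseteq> L" for n
      by (auto simp: extension_degree_def is_subfield_def)
    then have L: "is_subring L" "fraction_field Zp \<subseteq> L"
      using that by (auto simp: finite_unramified_def finite_extension_def)
    have "x \<in> fraction_field Zp" if "x \<in> Zp" for x
      unfolding fraction_field_def using that subring_one[OF Zp_residues(1)[OF Zp p0]]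
      by (intro CollectI exI[of _ x] exI[of _ 1]) auto
    then show "is_subring L" "Zp \<subseteq> L" "prime_element (integral_closure Zp L) ?P"
      using L that by (auto simp: finite_unramified_def)
  qed
  note sub = Zp_residues(1)[OF Zp p0]
  have "1 \<in> M" using M by (auto simp: maximal_unramified_def unramified_def is_subfield_def is_subring_def)
  then have "Zp \<subseteq> M" using M_ur[of 1] L_props(2) by blast
  then have ZO: "Zp \<subseteq> OM" unfolding OM_def by (rule integral_closure_base[OF sub])
  then show "Zp \<subseteq> R" using OR by blast
  have O_unit: "(\<exists>y\<in>OM. x * y = 1) \<or> cong_in OM ?P x 0" if x: "x \<in> OM" for x
  proof -
    obtain L where L: "finite_unramified p Zp L" "x \<in> L" "L \<subseteq> M"
      using M_ur[of x] x by (auto simp: OM_def integral_closure_def)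
    have "x \<in> integral_closure Zp L" "integral_closure Zp L \<subseteq> OM"
      using x L by (auto simp: OM_def integral_closure_def)
    then show ?thesis
      using L_props(3)[OF L(1)] unfolding prime_element_def cong_in_def by fastforce
  qed
  have O_one: "\<not> cong_in OM ?P 1 0"
  proof
    assume "cong_in OM ?P 1 0"
    then obtain t where t: "t \<in> OM" "?P * t = 1" by (auto simp: cong_in_def)
    obtain L where L: "finite_unramified p Zp L" "t \<in> L" "L \<subseteq> M"
      using M_ur[of t] t by (auto simp: OM_def integral_closure_def)
    have t': "t \<in> integral_closure Zp L" using t L by (auto simp: OM_def integral_closure_def)
    have "1 \<in> integral_closure Zp L"
      using integral_closure_base[OF sub L_props(2)[OF L(1)]] subring_one[OF sub] by blast
    then have "?P * 1 \<in> {x \<in> integral_closure Zp L. \<not> (\<exists>y\<in>integral_closure Zp L. x * y = 1)}"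
      using L_props(3)[OF L(1)] unfolding prime_element_def by blast
    then show False using t t' by auto
  qed
  \<comment> \<open>Two powers \<open>x^(p^a)\<close> and \<open>x^(p^b)\<close> agree modulo
    \<open>p\<close>. With b = a + k + 1, the difference z of x and \<open>x^(p^(k+1))\<close> is
    then nilpotent modulo \<open>p\<close>, hence zero there, and \<open>x^(p^k)\<close> is the
    required p-th root.\<close>
  have O_perfect: "\<exists>y\<in>OM. cong_in OM ?P x (y ^ p)" if x: "x \<in> OM" for x
  proof -
    obtain f where f: "f \<in> polys_over Zp" "lead_coeff f = 1" "poly f x = 0"
      using x by (auto simp: OM_def integral_closure_def)
    obtain a b where ab: "a < b" "cong_in (ring_adjoin Zp x) ?P (x ^ (p ^ a)) (x ^ (p ^ b))"
      using integral_powers_repeat_mod[OF sub f, of "of_nat ` {..<p}" ?P "\<lambda>k. p ^ k"]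
        Zp_residues(2)[OF Zp p0] by auto
    have ab': "cong_in OM ?P (x ^ (p ^ a)) (x ^ (p ^ b))"
      using cong_in_mono[OF ab(2)] ring_adjoin_least[OF OM ZO x] by blast
    obtain k where k: "b = a + Suc k" using ab(1) less_imp_Suc_add by auto
    define z where "z = x - x ^ (p ^ Suc k)"
    have z: "z \<in> OM" unfolding z_def by (intro subring_intros OM x)
    have "cong_in OM ?P (z ^ (p ^ a)) (x ^ (p ^ a) - (x ^ (p ^ Suc k)) ^ (p ^ a))"
      unfolding z_def by (intro power_diff_cong OM p x subring_power)
    also have "(x ^ (p ^ Suc k)) ^ (p ^ a) = x ^ (p ^ b)"
      unfolding k power_mult[symmetric] power_add[symmetric] by (simp add: add.commute)
    finally have "cong_in OM ?P (z ^ (p ^ a)) (x ^ (p ^ a) - x ^ (p ^ b))" .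
    moreover have "cong_in OM ?P (x ^ (p ^ a) - x ^ (p ^ b)) 0"
      using ab' by (simp add: cong_in_def)
    ultimately have z0: "cong_in OM ?P (z ^ (p ^ a)) 0" using cong_in_trans[OF OM] by blast
    have "cong_in OM ?P z 0"
    proof (rule ccontr)
      assume "\<not> cong_in OM ?P z 0"
      then obtain y where y: "y \<in> OM" "z * y = 1" using O_unit[OF z] by blast
      have "cong_in OM ?P (z ^ (p ^ a) * y ^ (p ^ a)) (0 * y ^ (p ^ a))"
        by (intro cong_in_mult cong_in_refl subring_power OM z0 y z)
      then show False using O_one y(2) by (simp add: power_mult_distrib[symmetric])
    qed
    then have "cong_in OM ?P x ((x ^ (p ^ k)) ^ p)"
      by (simp add: z_def cong_in_def power_mult[symmetric] mult.commute)
    then show ?thesis using x by (auto intro: subring_power OM)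
  qed
  show "strict_p_ring p R"
  proof
    show "prime p" "is_subring R" "padically_complete p R" by fact+
    \<comment> \<open>By injectivity of \<open>OM\<close> modulo \<open>p\<close> into
      \<open>R\<close> modulo \<open>p\<close>, such a congruence would already hold in
      \<open>OM\<close>.\<close>
    show "\<not> cong_in R ?P 1 0"
      using inj[of 1 1] O_one subring_one[OF OM] by auto
  next
    fix x assume x: "x \<in> R"
    obtain b where b: "b \<in> OM" "cong_in R ?P x b" using approx[OF x, of 1] by auto
    show "(\<exists>y\<in>R. x * y = 1) \<or> cong_in R ?P x 0"
      using O_unit[OF b(1)]
    proof
      assume "\<exists>y\<in>OM. b * y = 1"
      then obtain y where y: "y \<in> OM" "b * y = 1" by blast
      have yR: "y \<in> R" using y OR by blast
      have "cong_in R ?P (x * y) (b * y)"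
        by (intro cong_in_mult cong_in_refl R b x yR)
      then show ?thesis
        using complete_unit_if_cong_unit[OF R compl x yR] y(2) by simp
    next
      assume "cong_in OM ?P b 0"
      then show ?thesis using cong_in_trans[OF R b(2)] cong_in_mono OR by blast
    qed
    obtain y where "y \<in> OM" "cong_in OM ?P b (y ^ p)" using O_perfect[OF b(1)] by blast
    then show "\<exists>y\<in>R. cong_in R ?P x (y ^ p)"
      using cong_in_trans[OF R b(2)] cong_in_mono OR by blast
  qed
qed

lemma frobenius_lift_power:
  assumes "strict_p_ring p R" "frobenius_lift p R \<phi>" "s \<ge> 1"
  shows "frobenius_power p R (\<phi> ^^ s) s"
proof -
  interpret strict_p_ring p R by fact
  have hom: "ring_hom_on R R \<phi>" and frob: "\<And>a. a \<in> R \<Longrightarrow> cong_in R P (\<phi> a) (a ^ p)"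
    using assms(2) by (auto simp: frobenius_lift_def)
  have hom_k: "ring_hom_on R R (\<phi> ^^ k)" for k
  proof (induction k)
    case (Suc k)
    then show ?case using hom by (auto simp: ring_hom_on_def image_subset_iff)
  qed (auto simp: ring_hom_on_def)
  have "cong_in R P ((\<phi> ^^ k) a) (a ^ (p ^ k))" if a: "a \<in> R" for k a
  proof (induction k)
    case 0
    then show ?case by (simp add: cong_in_refl R)
  next
    case (Suc k)
    have b: "(\<phi> ^^ k) a \<in> R" using ring_hom_onD(1)[OF hom_k a] .
    have "cong_in R P ((\<phi> ^^ k) a ^ p) ((a ^ (p ^ k)) ^ p)"
      by (intro cong_in_power Suc R b a subring_power)
    then show ?case
      using cong_in_trans[OF R frob[OF b]] by (simp add: power_mult[symmetric] mult.commute)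
  qed
  then show ?thesis using hom_k assms(3) by unfold_locales auto
qed

section \<open>Coordinates and \<open>\<pi>\<close>-derivations\<close>

context
  fixes R B :: "'k::field set" and \<theta> :: "'n::finite \<Rightarrow> 'k"
  assumes R: "is_subring R" and basis: "is_basis R UNIV \<theta> B"
begin

lemma basis_combination_in: "a \<in> curves R \<Longrightarrow> (\<Sum>i\<in>UNIV. a $ i * \<theta> i) \<in> B"
  using basis by (auto simp: is_basis_def curves_def)

lemma basis_unique:
  assumes "a \<in> curves R" "b \<in> curves R" "(\<Sum>i\<in>UNIV. a $ i * \<theta> i) = (\<Sum>i\<in>UNIV. b $ i * \<theta> i)"
  shows "a = b"
proof -
  have "(\<Sum>i\<in>UNIV. (a $ i - b $ i) * \<theta> i) = 0"
    using assms(3) by (simp add: left_diff_distrib sum_subtractf)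
  moreover have "\<forall>i\<in>UNIV. a $ i - b $ i \<in> R"
    using assms R by (auto simp: curves_def intro: subring_diff)
  ultimately have "\<forall>i\<in>UNIV. a $ i - b $ i = 0"
    using basis[unfolded is_basis_def, THEN conjunct2, THEN conjunct2, THEN spec,
        of "\<lambda>i. a $ i - b $ i"] by blast
  then show ?thesis by (simp add: vec_eq_iff)
qed

lemma coords_combination:
  "a \<in> curves R \<Longrightarrow> coords R \<theta> (\<Sum>i\<in>UNIV. a $ i * \<theta> i) = a"
  unfolding coords_def by (rule the_equality) (auto dest: basis_unique)

lemma coords:
  assumes "y \<in> B"
  shows "coords R \<theta> y \<in> curves R" "y = (\<Sum>i\<in>UNIV. coords R \<theta> y $ i * \<theta> i)"
proof -
  obtain a where a: "\<forall>i. a i \<in> R" "y = (\<Sum>i\<in>UNIV. a i * \<theta> i)"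
    using basis assms by (auto simp: is_basis_def)
  then have "(\<chi> i. a i) \<in> curves R" "y = (\<Sum>i\<in>UNIV. (\<chi> i. a i) $ i * \<theta> i)"
    by (auto simp: curves_def)
  then show "coords R \<theta> y \<in> curves R" "y = (\<Sum>i\<in>UNIV. coords R \<theta> y $ i * \<theta> i)"
    using coords_combination by metis+
qed

text \<open>\<open>coords\<close> is a definite description, meaningful on \<open>B\<close>. The
  combination of the coordinate vectors represents the combined element, and uniqueness of
  representations identifies it with the value of \<open>coords\<close>.\<close>

lemma curve_pullback_sum:
  fixes a y :: "'i \<Rightarrow> 'k"
  assumes "\<And>i. i \<in> I \<Longrightarrow> a i \<in> R" "\<And>i. i \<in> I \<Longrightarrow> y i \<in> B"
  shows "curve_pullback R \<theta> c (\<Sum>i\<in>I. a i * y i) = (\<Sum>i\<in>I. a i * curve_pullback R \<theta> c (y i))"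
proof -
  define b where "b = (\<chi> l. \<Sum>i\<in>I. a i * coords R \<theta> (y i) $ l)"
  have b: "b \<in> curves R"
    using assms(1) coords(1)[OF assms(2)]
    by (auto simp: b_def curves_def intro!: subring_sum subring_mult R)
  have "(\<Sum>i\<in>I. a i * y i) = (\<Sum>i\<in>I. a i * (\<Sum>l\<in>UNIV. coords R \<theta> (y i) $ l * \<theta> l))"
    by (intro sum.cong refl arg_cong[where f = "(*) _"] coords(2) assms)
  also have "\<dots> = (\<Sum>l\<in>UNIV. b $ l * \<theta> l)"
    unfolding b_def sum_distrib_left
    by (subst sum.swap) (simp add: sum_distrib_right mult.assoc)
  finally have "coords R \<theta> (\<Sum>i\<in>I. a i * y i) = b" using coords_combination[OF b] by simp
  then show ?thesis
    unfolding curve_pullback_def b_def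
    by (simp add: sum_distrib_right sum_distrib_left mult.assoc, subst sum.swap, simp)
qed

lemma curve_pullback_add:
  assumes "y \<in> B" "z \<in> B"
  shows "curve_pullback R \<theta> c (y + z) = curve_pullback R \<theta> c y + curve_pullback R \<theta> c z"
  using curve_pullback_sum[of "{True, False}" "\<lambda>_. 1" "\<lambda>b. if b then y else z"]
    assms subring_one[OF R] by simp

lemma curve_pullback_scale:
  assumes "a \<in> R" "y \<in> B"
  shows "curve_pullback R \<theta> c (a * y) = a * curve_pullback R \<theta> c y"
  using curve_pullback_sum[of "{()}" "\<lambda>_. a" "\<lambda>_. y"] assms by simp

end

text \<open>Divisibility by \<open>P^m\<close> in the free module is divisibility of every
  coordinate, so separation is inherited coordinatewise from \<open>R\<close>.\<close>

lemma (in strict_p_ring) basis_separated: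
  fixes \<theta> :: "'n::finite \<Rightarrow> 'k"
  assumes basis: "is_basis R UNIV \<theta> B" and x: "x \<in> B" "\<And>m. cong_in B (P ^ m) x 0"
  shows "x = 0"
proof -
  note co = coords[OF R basis]
  have "coords R \<theta> x $ i = 0" for i
  proof (rule eq_if_cong_all)
    fix m
    obtain t where t: "t \<in> B" "x = P ^ m * t" using x(2)[of m] by (auto simp: cong_in_def)
    define b where "b = (\<chi> l. P ^ m * coords R \<theta> t $ l)"
    have b: "b \<in> curves R"
      using co(1)[OF t(1)] P_in R by (auto simp: b_def curves_def intro: subring_mult subring_power)
    have "x = P ^ m * (\<Sum>l\<in>UNIV. coords R \<theta> t $ l * \<theta> l)" using t co(2) by metis
    then have "x = (\<Sum>l\<in>UNIV. b $ l * \<theta> l)" by (simp add: b_def sum_distrib_left mult.assoc)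
    then have "coords R \<theta> x = b" using coords_combination[OF R basis b] by simp
    then show "cong_in R (P ^ m) (coords R \<theta> x $ i) 0"
      using co(1)[OF t(1)] by (auto simp: b_def curves_def intro!: cong_inI)
  qed (use co(1)[OF x(1)] R in \<open>auto simp: curves_def intro: subring_zero\<close>)
  then show ?thesis using co(2)[OF x(1)] by simp
qed

text \<open>The axioms of a higher \<pi>-derivation are the homomorphism identities with a factor
  \<pi> removed: multiplied by \<pi>, the term with \<rho> becomes \<open>p * C_poly\<close>, the
  defect of additivity of the power map.\<close>

lemma higher_pi_derivation_hom:
  assumes p: "prime p" and A: "is_subring A" "\<pi> \<in> A" "\<pi> * \<rho> = of_nat p"
    and \<delta>: "higher_pi_derivation p s \<pi> \<rho> A \<delta>"
  shows "ring_hom_on A A (\<lambda>x. x ^ (p ^ s) + \<pi> * \<delta> x)"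
  unfolding ring_hom_on_def
proof (intro conjI ballI)
  have in_A: "\<And>x. x \<in> A \<Longrightarrow> \<delta> x \<in> A" and one: "\<delta> 1 = 0"
    and add: "\<And>x y. x \<in> A \<Longrightarrow> y \<in> A \<Longrightarrow> \<delta> (x + y) = \<delta> x + \<delta> y + \<rho> * C_poly p s x y"
    and mult: "\<And>x y. x \<in> A \<Longrightarrow> y \<in> A \<Longrightarrow>
      \<delta> (x * y) = x ^ (p ^ s) * \<delta> y + y ^ (p ^ s) * \<delta> x + \<pi> * \<delta> x * \<delta> y"
    using \<delta> by (auto simp: higher_pi_derivation_def)
  show "(\<lambda>x. x ^ (p ^ s) + \<pi> * \<delta> x) ` A \<subseteq> A" using in_A A by (auto intro: subring_intros)
  show "1 ^ (p ^ s) + \<pi> * \<delta> 1 = 1" by (simp add: one)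
  fix x y assume xy: "x \<in> A" "y \<in> A"
  have "\<pi> * \<delta> (x + y) = \<pi> * \<delta> x + \<pi> * \<delta> y + \<pi> * \<rho> * C_poly p s x y"
    by (simp add: add[OF xy] algebra_simps)
  then show "(x + y) ^ (p ^ s) + \<pi> * \<delta> (x + y) = x ^ (p ^ s) + \<pi> * \<delta> x + (y ^ (p ^ s) + \<pi> * \<delta> y)"
    by (simp add: A(3) C_poly_eq[OF p])
  show "(x * y) ^ (p ^ s) + \<pi> * \<delta> (x * y) = (x ^ (p ^ s) + \<pi> * \<delta> x) * (y ^ (p ^ s) + \<pi> * \<delta> y)"
    by (simp add: mult[OF xy] power_mult_distrib algebra_simps)
qed

lemma (in frobenius_power) pi_derivation_restrict:
  fixes \<theta> :: "'n::finite \<Rightarrow> 'k"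
  assumes B: "is_subring B" "\<pi> \<in> B" "\<rho> \<in> B" "\<pi> * \<rho> = P" "R \<subseteq> B"
    and nil: "cong_in B P (\<pi> ^ e) 0" and basis: "is_basis R UNIV \<theta> B"
    and \<delta>: "higher_pi_derivation p s \<pi> \<rho> B \<delta>" and a: "a \<in> R"
  shows "a ^ (p ^ s) + \<pi> * \<delta> a = \<sigma> a"
proof -
  let ?f = "\<lambda>x. x ^ (p ^ s) + \<pi> * \<delta> x"
  have hom_B: "ring_hom_on B B ?f" by (rule higher_pi_derivation_hom[OF p B(1,2,4) \<delta>])
  then have f: "ring_hom_on R B ?f" using B(5) by (auto simp: ring_hom_on_def)
  have g: "ring_hom_on R B \<sigma>" using hom B(5) by (auto simp: ring_hom_on_def)
  have fg: "cong_in B \<pi> (?f x) (\<sigma> x)" if x: "x \<in> R" for x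
  proof -
    have "cong_in B (\<pi> * \<rho>) (\<sigma> x) (x ^ (p ^ s))"
      using cong_in_mono[OF frob[OF x] B(5)] by (simp add: B(4))
    then have 1: "cong_in B \<pi> (\<sigma> x) (x ^ (p ^ s))"
      by (rule cong_in_dvd_modulus[OF B(1) _ B(3)])
    have "\<delta> x \<in> B" using \<delta> x B(5) by (auto simp: higher_pi_derivation_def)
    then have "cong_in B \<pi> (?f x) (x ^ (p ^ s))" by (auto intro: cong_inI)
    then show ?thesis using 1 cong_in_trans[OF B(1)] cong_in_sym[OF B(1)] by blast
  qed
  \<comment> \<open>Since P divides \<open>\<pi>^e\<close>, agreement modulo
    \<open>\<pi>^(e * m)\<close> gives agreement modulo \<open>P^m\<close>, the form in which
    freeness over \<open>R\<close> yields separation.\<close>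
  obtain t where t: "t \<in> B" "\<pi> ^ e = P * t" using nil by (auto simp: cong_in_def)
  have "cong_in B (P ^ m) (?f a - \<sigma> a) 0" for m
  proof -
    have "cong_in B (\<pi> ^ (e * m)) (?f a) (\<sigma> a)"
      by (rule ring_hom_cong_all[OF B(1-4) f g fg a])
    then have "cong_in B (P ^ m * t ^ m) (?f a) (\<sigma> a)"
      by (simp add: power_mult t(2) power_mult_distrib)
    then have "cong_in B (P ^ m) (?f a) (\<sigma> a)"
      by (rule cong_in_dvd_modulus[OF B(1)]) (intro subring_power B t)
    then show ?thesis by (simp add: cong_in_def)
  qed
  moreover have "?f a - \<sigma> a \<in> B"
    using ring_hom_onD(1)[OF f a] ring_hom_onD(1)[OF g a] by (intro subring_diff B)
  ultimately show ?thesis using basis_separated[OF basis] by fastforce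
qed

section \<open>Constants and coordinates in the ring of the general linear group\<close>

lemma matpoly_const_in_GL_ring:
  "is_subring B \<Longrightarrow> b \<in> B \<Longrightarrow> Fract (matpoly_const b) 1 \<in> GL_ring B"
  unfolding GL_ring_def
  by (intro CollectI exI[of _ "matpoly_const b"] exI[of _ 0])
    (auto simp: matpoly_const_def lookup_single when_def subring_zero)

lemma matpoly_vars_in_GL_ring:
  "is_subring B \<Longrightarrow> Fract (matpoly_vars $ i $ j) 1 \<in> GL_ring B"
  unfolding GL_ring_def
  by (intro CollectI exI[of _ "matpoly_vars $ i $ j"] exI[of _ 0])
    (auto simp: matpoly_vars_def lookup_single when_def subring_zero subring_one)

lemma const_image_hom:
  fixes h :: "('n::{finite,linorder}, 'k::idom) matpoly fract \<Rightarrow> 'a::comm_ring_1"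
  assumes h: "ring_hom_on (GL_ring B) A h" and B: "is_subring B"
  shows "ring_hom_on B A (const_image h)"
  unfolding ring_hom_on_def
proof (intro conjI ballI)
  note in_GL = matpoly_const_in_GL_ring[OF B]
  show "const_image h ` B \<subseteq> A"
    using ring_hom_onD(1)[OF h] in_GL by (auto simp: const_image_def)
  have "Fract (matpoly_const 1) 1 = (1 :: ('n, 'k) matpoly fract)"
    by (simp add: matpoly_const_def single_one One_fract_def)
  then show "const_image h 1 = 1" using ring_hom_onD(2)[OF h] by (simp add: const_image_def)
  fix x y assume xy: "x \<in> B" "y \<in> B"
  have "Fract (matpoly_const (x + y)) 1 =
      Fract (matpoly_const x) 1 + (Fract (matpoly_const y) 1 :: ('n, 'k) matpoly fract)"
    by (simp add: matpoly_const_def single_add)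
  then show "const_image h (x + y) = const_image h x + const_image h y"
    using ring_hom_onD(3)[OF h in_GL[OF xy(1)] in_GL[OF xy(2)]] by (simp add: const_image_def)
  have "Fract (matpoly_const (x * y)) 1 =
      Fract (matpoly_const x) 1 * (Fract (matpoly_const y) 1 :: ('n, 'k) matpoly fract)"
    by (simp add: matpoly_const_def mult_single)
  then show "const_image h (x * y) = const_image h x * const_image h y"
    using ring_hom_onD(4)[OF h in_GL[OF xy(1)] in_GL[OF xy(2)]] by (simp add: const_image_def)
qed

section \<open>Geodesics\<close>

context frobenius_power
begin

text \<open>With \<sigma> equal to \<open>\<phi> ^^ s\<close> this is
  \<open>delta p \<phi> s\<close>.\<close>

definition D :: "'k \<Rightarrow> 'k" where "D a = (\<sigma> a - a ^ (p ^ s)) / P"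

lemma \<sigma>_eq: "\<sigma> a = a ^ (p ^ s) + P * D a"
  using P_nonzero by (simp add: D_def)

lemma D_in:
  assumes "a \<in> R"
  shows "D a \<in> R"
proof -
  obtain t where "t \<in> R" "\<sigma> a - a ^ (p ^ s) = P * t" using frob[OF assms] by (auto simp: cong_in_def)
  then show ?thesis using P_nonzero by (simp add: D_def)
qed

lemma \<tau>_arg_in: "x \<in> R \<Longrightarrow> y \<in> R \<Longrightarrow> x ^ (p ^ s) + P * y \<in> R"
  by (intro subring_add[OF R] subring_power[OF R] subring_mult[OF R] P_in)

text \<open>A differential equation becomes a fixed point equation: \<open>D x = y\<close> says
  exactly that \<open>\<sigma> x\<close> equals the argument of \<tau>.\<close>

lemma \<tau>_fixed_iff:
  assumes "x \<in> R" "y \<in> R"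
  shows "\<tau> (x ^ (p ^ s) + P * y) = x \<longleftrightarrow> D x = y"
  using \<tau>_eq_iff[OF \<tau>_arg_in[OF assms] assms(1)] \<sigma>_eq[of x] P_nonzero by simp

text \<open>Modulo P the summand \<open>P * y\<close> vanishes and the power of x is congruent to
  \<open>\<sigma> x0\<close>. The update thus stays in the residue class of x0 whatever y
  is.\<close>

lemma \<tau>_cong_base:
  assumes "x \<in> R" "y \<in> R" "x0 \<in> R" "cong_in R P x x0"
  shows "cong_in R P (\<tau> (x ^ (p ^ s) + P * y)) x0"
proof -
  have "cong_in R P (x ^ (p ^ s) + P * y) (x ^ (p ^ s))"
    using assms by (intro cong_inI[of y]) auto
  moreover have "cong_in R P (x ^ (p ^ s)) (x0 ^ (p ^ s))" by (intro cong_in_power R assms)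
  ultimately have "cong_in R P (x ^ (p ^ s) + P * y) (\<sigma> x0)"
    using cong_in_trans[OF R] cong_in_sym[OF R frob[OF assms(3)]] by blast
  then have "cong_in R (P ^ 1) (\<tau> (x ^ (p ^ s) + P * y)) (\<tau> (\<sigma> x0))"
    by (intro \<tau>_cong \<tau>_arg_in \<sigma>_in assms) simp
  moreover have "\<tau> (\<sigma> x0) = x0" using \<tau>_eq_iff[OF \<sigma>_in] assms(3) by simp
  ultimately show ?thesis by simp
qed

text \<open>The power map and multiplication by P each gain a factor P, and \<tau> loses
  none.\<close>

lemma \<tau>_contract:
  assumes "x \<in> R" "y \<in> R" "x' \<in> R" "y' \<in> R"
    and "cong_in R (P ^ Suc m) x x'" "cong_in R (P ^ Suc m) y y'"
  shows "cong_in R (P ^ Suc (Suc m)) (\<tau> (x ^ (p ^ s) + P * y)) (\<tau> (x' ^ (p ^ s) + P * y'))"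
proof (intro \<tau>_cong \<tau>_arg_in cong_in_add R cong_in_power_Suc s assms)
  show "cong_in R (P ^ Suc (Suc m)) (P * y) (P * y')"
    unfolding power_Suc[of P "Suc m"] by (rule cong_in_scale[OF assms(6)])
qed

lemma inverse_cong:
  assumes "cong_in R m x y" "inverse x \<in> R" "inverse y \<in> R" "x \<noteq> 0" "y \<noteq> 0"
  shows "cong_in R m (inverse x) (inverse y)"
proof -
  obtain t where t: "t \<in> R" "x - y = m * t" using assms(1) by (auto simp: cong_in_def)
  have "inverse x - inverse y = - (x - y) * (inverse x * inverse y)"
    using assms(4,5) by (simp add: field_simps)
  also have "\<dots> = m * (- t * (inverse x * inverse y))" by (simp add: t(2))
  finally show ?thesis
    by (rule cong_inI[rotated]) (use assms t R in \<open>auto intro!: subring_intros\<close>)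
qed

text \<open>In the variables \<open>(c, v)\<close> the equation \<open>U \<cdot> D v + N = 0\<close> with \<open>v = D c\<close> says that \<open>(c, v)\<close> is a
  fixed point of \<open>(c, v) \<mapsto> (\<tau> (c\<^sup>q + p v), \<tau> (v\<^sup>q - p N / U))\<close>, where \<open>\<tau> = \<sigma>\<^sup>-\<^sup>1\<close> and \<open>q = p\<^sup>s\<close>.\<close>

lemma second_order_equation:
  fixes c0 :: "'k ^ 'n" and N :: "'k ^ 'n \<Rightarrow> 'k ^ 'n \<Rightarrow> 'n \<Rightarrow> 'k" and U :: "'k ^ 'n \<Rightarrow> 'k ^ 'n \<Rightarrow> 'k"
  defines "vel \<equiv> \<lambda>c. \<chi> i. D (c $ i)"
  defines "near \<equiv> \<lambda>c v. c \<in> curves R \<and> v \<in> curves R \<and> vec_cong R p c c0 \<and> vec_cong R p v (vel c0)"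
  assumes c0: "c0 \<in> curves R"
    and N_in: "\<And>c v k. c \<in> curves R \<Longrightarrow> v \<in> curves R \<Longrightarrow> N c v k \<in> R"
    and N_cong: "\<And>c v c' v' m k. c \<in> curves R \<Longrightarrow> v \<in> curves R \<Longrightarrow> c' \<in> curves R \<Longrightarrow> v' \<in> curves R \<Longrightarrow>
      (\<And>i. cong_in R (P ^ m) (c $ i) (c' $ i)) \<Longrightarrow> (\<And>i. cong_in R (P ^ m) (v $ i) (v' $ i)) \<Longrightarrow>
      cong_in R (P ^ m) (N c v k) (N c' v' k)"
    and U_cong: "\<And>c v c' v' m. c \<in> curves R \<Longrightarrow> v \<in> curves R \<Longrightarrow> c' \<in> curves R \<Longrightarrow> v' \<in> curves R \<Longrightarrow>
      (\<And>i. cong_in R (P ^ m) (c $ i) (c' $ i)) \<Longrightarrow> (\<And>i. cong_in R (P ^ m) (v $ i) (v' $ i)) \<Longrightarrow>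
      cong_in R (P ^ m) (U c v) (U c' v')"
    and U_unit: "\<And>c v. near c v \<Longrightarrow> inverse (U c v) \<in> R \<and> U c v \<noteq> 0"
  shows "\<exists>!c. near c (vel c) \<and> (\<forall>k. U c (vel c) * D (vel c $ k) + N c (vel c) k = 0)"
proof -
  define C where "C = (\<lambda>w :: 'n + 'n \<Rightarrow> 'k. \<chi> i. w (Inl i))"
  define V where "V = (\<lambda>w :: 'n + 'n \<Rightarrow> 'k. \<chi> i. w (Inr i))"
  \<comment> \<open>The value that the equation prescribes for \<open>D\<close> of the k-th velocity
    component.\<close>
  define G where "G = (\<lambda>w k. - N (C w) (V w) k * inverse (U (C w) (V w)))"
  define T where "T = (\<lambda>w. case_sum (\<lambda>i. \<tau> (w (Inl i) ^ (p ^ s) + P * w (Inr i)))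
    (\<lambda>i. \<tau> (w (Inr i) ^ (p ^ s) + P * G w i)))"
  define w0 where "w0 = case_sum (($) c0) (($) (vel c0))"
  define X where "X = {w. \<forall>i. w i \<in> R \<and> cong_in R P (w i) (w0 i)}"
  \<comment> \<open>The two congruence conditions on c and v together describe one residue class in
    2n coordinates, centred at c0 and its velocity.\<close>
  have near_iff: "near (C w) (V w) \<longleftrightarrow> w \<in> X" for w
    by (auto simp: near_def X_def w0_def C_def V_def curves_def vec_cong_def split_sum_all)
  have X_in: "w i \<in> R" if "w \<in> X" for w i using that by (simp add: X_def)
  have CV_in: "C w \<in> curves R" "V w \<in> curves R" if "w \<in> X" for w
    using X_in[OF that] by (auto simp: C_def V_def curves_def)
  have U: "inverse (U (C w) (V w)) \<in> R" "U (C w) (V w) \<noteq> 0" if "w \<in> X" for w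
    using U_unit near_iff that by blast+
  have G_in: "G w k \<in> R" if "w \<in> X" for w k
    unfolding G_def using that by (intro subring_intros R U N_in CV_in)
  have vel_in: "vel c \<in> curves R" if "c \<in> curves R" for c
    using that by (auto simp: vel_def curves_def intro: D_in)
  have w0: "w0 i \<in> R" for i
    using c0 vel_in[OF c0] by (auto simp: w0_def curves_def split: sum.split)
  have ex1: "\<exists>!w. w \<in> {w. \<forall>i. w i \<in> R \<and> cong_in R P (w i) (w0 i)} \<and> T w = w"
  proof (rule contraction_fixed_point[OF w0], unfold X_def[symmetric])
    fix w assume w: "w \<in> X"
    show "T w \<in> X"
      unfolding X_def
    proof (intro CollectI allI conjI)
      fix i
      show "T w i \<in> R"
        unfolding T_def by (cases i) (auto intro!: \<tau>(1) \<tau>_arg_in X_in[OF w] G_in[OF w])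
      have "cong_in R P (w i) (w0 i)" using w by (simp add: X_def)
      then show "cong_in R P (T w i) (w0 i)"
        unfolding T_def by (cases i) (auto intro!: \<tau>_cong_base X_in[OF w] G_in[OF w] w0)
    qed
  next
    fix w w' m i assume w: "w \<in> X" "w' \<in> X" and c: "\<And>i. cong_in R (P ^ Suc m) (w i) (w' i)"
    have "cong_in R (P ^ Suc m) (N (C w) (V w) k) (N (C w') (V w') k)" for k
      by (intro N_cong CV_in w) (simp_all only: C_def V_def vec_lambda_beta c)
    moreover have "cong_in R (P ^ Suc m) (U (C w) (V w)) (U (C w') (V w'))"
      by (intro U_cong CV_in w) (simp_all only: C_def V_def vec_lambda_beta c)
    ultimately have "cong_in R (P ^ Suc m) (G w k) (G w' k)" for k
      unfolding G_def by (intro cong_in_mult cong_in_uminus inverse_cong R U subring_uminus N_in CV_in w)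
    then show "cong_in R (P ^ Suc (Suc m)) (T w i) (T w' i)"
      unfolding T_def
      by (cases i) (auto simp del: power_Suc intro!: \<tau>_contract X_in[OF w(1)] X_in[OF w(2)]
          G_in[OF w(1)] G_in[OF w(2)] c)
  qed
  have fixed_iff: "T w = w \<longleftrightarrow> V w = vel (C w) \<and>
      (\<forall>k. U (C w) (V w) * D (V w $ k) + N (C w) (V w) k = 0)" if w: "w \<in> X" for w
  proof -
    have "T w = w \<longleftrightarrow> (\<forall>i. T w (Inl i) = w (Inl i)) \<and> (\<forall>i. T w (Inr i) = w (Inr i))"
      by (simp add: fun_eq_iff split_sum_all)
    also have "\<dots> \<longleftrightarrow> (\<forall>i. D (w (Inl i)) = w (Inr i)) \<and> (\<forall>i. D (w (Inr i)) = G w i)"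
      unfolding T_def by (simp add: \<tau>_fixed_iff X_in[OF w] G_in[OF w])
    also have "(\<forall>i. D (w (Inl i)) = w (Inr i)) \<longleftrightarrow> V w = vel (C w)"
      by (auto simp: V_def C_def vel_def vec_eq_iff)
    also have "(\<forall>i. D (w (Inr i)) = G w i) \<longleftrightarrow>
        (\<forall>k. U (C w) (V w) * D (V w $ k) + N (C w) (V w) k = 0)"
    proof (intro all_cong1)
      fix k
      have V_k: "V w $ k = w (Inr k)" by (simp add: V_def)
      have "d = - n * inverse u \<longleftrightarrow> u * d + n = 0" if "u \<noteq> 0" for d n u :: 'k
        unfolding eq_neg_iff_add_eq_0[symmetric] using that
        by (metis divide_inverse nonzero_mult_div_cancel_left nonzero_divide_eq_eq mult.commute)
      then show "D (w (Inr k)) = G w k \<longleftrightarrow> U (C w) (V w) * D (V w $ k) + N (C w) (V w) k = 0"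
        using U(2)[OF w] unfolding V_k G_def by blast
    qed
    finally show ?thesis .
  qed
  \<comment> \<open>A fixed point is determined by its curve half, because its other half is the
    velocity of that curve. So W and C match solutions with fixed points, and unique existence
    transfers.\<close>
  define W where "W = (\<lambda>c. case_sum (($) c) (($) (vel c)))"
  have CW: "C (W c) = c" "V (W c) = vel c" for c by (simp_all add: C_def V_def W_def vec_eq_iff)
  have WC: "W (C w) = w" if "V w = vel (C w)" for w
    using that by (intro ext) (auto simp: W_def C_def V_def vec_eq_iff split: sum.split)
  have iff: "near c (vel c) \<and> (\<forall>k. U c (vel c) * D (vel c $ k) + N c (vel c) k = 0) \<longleftrightarrow>
      W c \<in> X \<and> T (W c) = W c" for c
    using near_iff[of "W c"] fixed_iff[of "W c"] by (auto simp: CW)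
  obtain w where w: "w \<in> X" "T w = w" and uniq: "\<And>w'. w' \<in> X \<Longrightarrow> T w' = w' \<Longrightarrow> w' = w"
    using ex1 unfolding X_def[symmetric] by blast
  have Ww: "W (C w) = w" using WC fixed_iff w by blast
  show ?thesis
    unfolding iff
  proof (rule ex1I[of _ "C w"])
    show "W (C w) \<in> X \<and> T (W (C w)) = W (C w)" using w Ww by simp
    fix c assume "W c \<in> X \<and> T (W c) = W c"
    then have "W c = w" using uniq by blast
    then show "c = C w" using CW(1)[of c] by simp
  qed
qed

end

section \<open>The geodesic equation evaluated at the identity matrix\<close>

lemma ring_hom_on_comp:
  "ring_hom_on A B f \<Longrightarrow> ring_hom_on B C g \<Longrightarrow> ring_hom_on A C (\<lambda>x. g (f x))"
  by (auto simp: ring_hom_on_def image_subset_iff)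

text \<open>The key identity: since \<open>F \<mapsto> F\<^sup>q + \<pi> \<delta>\<^sup>G F\<close> is a ring homomorphism extending \<open>\<phi>\<^sup>s\<close>,
  \<open>\<delta>\<^sup>G(xv)\<close> at \<open>x = 1\<close> is \<open>(p/\<pi>) \<delta>\<^sup>(\<^sup>s\<^sup>)v + \<Gamma> v\<^sup>\<phi>\<close> with Christoffel symbols
  \<open>\<Gamma> = \<delta>\<^sup>G(x)(1)\<close>.\<close>

lemma (in frobenius_power) pi_connection_at_one:
  fixes h :: "('n::{finite,linorder}, 'k) matpoly fract \<Rightarrow> 'a::comm_ring_1"
  assumes B: "is_subring B" "\<pi> \<in> B" "P / \<pi> \<in> B" "\<pi> \<noteq> 0" "R \<subseteq> B"
    and h: "ring_hom_on (GL_ring B) A h" and A: "is_subring A"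
    and ev: "eval_at_one B h A ev" and conn: "pi_connection p s \<pi> B h A \<delta> \<delta>G"
    and restrict: "\<And>i a. a \<in> R \<Longrightarrow> a ^ (p ^ s) + \<pi> * \<delta> i a = \<sigma> a"
    and \<delta>_in: "\<And>i b. b \<in> B \<Longrightarrow> \<delta> i b \<in> B"
    and v: "v \<in> curves R"
  shows "ev (\<delta>G i ((coord_matrix h *v (\<chi> j. const_image h (v $ j))) $ k)) =
    P / \<pi> * D (v $ k) + (\<Sum>j\<in>UNIV. \<sigma> (v $ j) * ev (\<delta>G i (coord_matrix h $ k $ j)))"
proof -
  let ?x = "coord_matrix h" and ?c = "const_image h"
  have c: "ring_hom_on B A ?c" by (rule const_image_hom[OF h B(1)])
  have e: "ring_hom_on A B ev" and ev_c: "\<And>b. b \<in> B \<Longrightarrow> ev (?c b) = b"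
    and ev_x: "\<And>k j. ev (?x $ k $ j) = (if k = j then 1 else 0)"
    using ev by (auto simp: eval_at_one_def mat_def vec_eq_iff)
  have x_in: "?x $ k $ j \<in> A" for k j
    using ring_hom_onD(1)[OF h matpoly_vars_in_GL_ring[OF B(1)]] by (simp add: coord_matrix_def)
  have v_B: "v $ j \<in> B" and v_R: "v $ j \<in> R" for j using v B(5) by (auto simp: curves_def)
  have c_in: "?c b \<in> A" if "b \<in> B" for b using ring_hom_onD(1)[OF c that] .
  have der: "higher_pi_derivation p s (?c \<pi>) (?c (P / \<pi>)) A (\<delta>G i)"
    and ext: "\<And>b. b \<in> B \<Longrightarrow> \<delta>G i (?c b) = ?c (\<delta> i b)"
    using conn by (auto simp: pi_connection_def)
  have "?c \<pi> * ?c (P / \<pi>) = of_nat p"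
    using ring_hom_onD(4)[OF c B(2,3)] ring_hom_on_of_nat[OF c B(1), of p] B(4) by simp
  then have "ring_hom_on A A (\<lambda>F. F ^ (p ^ s) + ?c \<pi> * \<delta>G i F)"
    by (rule higher_pi_derivation_hom[OF p A c_in[OF B(2)] _ der])
  then have "ring_hom_on A B (\<lambda>F. ev (F ^ (p ^ s) + ?c \<pi> * \<delta>G i F))"
    by (rule ring_hom_on_comp[OF _ e])
  moreover have \<delta>G_in: "\<delta>G i F \<in> A" if "F \<in> A" for F
    using der that by (auto simp: higher_pi_derivation_def)
  have \<Psi>_eq: "ev (F ^ (p ^ s) + ?c \<pi> * \<delta>G i F) = ev F ^ (p ^ s) + \<pi> * ev (\<delta>G i F)" if "F \<in> A" for F
    using that \<delta>G_in[OF that] c_in[OF B(2)]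
    by (simp add: ring_hom_onD[OF e] ring_hom_on_power[OF e A] ev_c[OF B(2)]
        subring_power[OF A] subring_mult[OF A])
  define \<Psi> where "\<Psi> = (\<lambda>F. ev (F ^ (p ^ s) + ?c \<pi> * \<delta>G i F))"
  ultimately have \<Psi>: "ring_hom_on A B \<Psi>" by simp
  define F where "F = (?x *v (\<chi> j. ?c (v $ j))) $ k"
  have F: "F = (\<Sum>j\<in>UNIV. ?x $ k $ j * ?c (v $ j))"
    by (simp add: F_def matrix_vector_mult_def)
  have terms: "?x $ k $ j * ?c (v $ j) \<in> A" for j by (intro subring_mult A x_in c_in v_B)
  have F_in: "F \<in> A" unfolding F by (intro subring_sum A terms)
  have "ev F = (\<Sum>j\<in>UNIV. (if k = j then 1 else 0) * v $ j)"
    unfolding F using ring_hom_on_sum[OF e A, of UNIV "\<lambda>j. ?x $ k $ j * ?c (v $ j)"] terms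
    by (simp add: ring_hom_onD(4)[OF e x_in c_in[OF v_B]] ev_x ev_c v_B)
  also have "\<dots> = v $ k" by (simp add: if_distrib[of "\<lambda>t. t * _"] cong: if_cong)
  finally have ev_F: "ev F = v $ k" .
  have \<Psi>_c: "\<Psi> (?c (v $ j)) = \<sigma> (v $ j)" for j
    unfolding \<Psi>_def unfolding \<Psi>_eq[OF c_in[OF v_B]]
    unfolding ext[OF v_B] ev_c[OF v_B] ev_c[OF \<delta>_in[OF v_B]]
    by (rule restrict[OF v_R])
  \<comment> \<open>A positive exponent makes the off-diagonal zeros of the identity matrix stay
    zero under the power map.\<close>
  have q0: "p ^ s \<noteq> 0" using p by (simp add: prime_gt_0_nat)
  have \<Psi>_x: "\<Psi> (?x $ k $ j) = (if k = j then 1 else 0) + \<pi> * ev (\<delta>G i (?x $ k $ j))" for j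
    unfolding \<Psi>_def \<Psi>_eq[OF x_in] ev_x using q0 by (simp add: zero_power)
  \<comment> \<open>\<open>\<Psi> F\<close> is computed twice: by its defining formula, using
    \<open>ev F = v $ k\<close>, and termwise by additivity and multiplicativity.\<close>
  have "(v $ k) ^ (p ^ s) + \<pi> * ev (\<delta>G i F) = \<Psi> F"
    unfolding \<Psi>_def \<Psi>_eq[OF F_in] ev_F ..
  also have "\<dots> = (\<Sum>j\<in>UNIV. \<Psi> (?x $ k $ j) * \<sigma> (v $ j))"
    unfolding F using ring_hom_on_sum[OF \<Psi> A, of UNIV "\<lambda>j. ?x $ k $ j * ?c (v $ j)"] terms
    by (simp add: ring_hom_onD(4)[OF \<Psi> x_in c_in[OF v_B]] \<Psi>_c)
  also have "\<dots> = (\<Sum>j\<in>UNIV. (if k = j then \<sigma> (v $ j) else 0) + \<pi> * (\<sigma> (v $ j) * ev (\<delta>G i (?x $ k $ j))))"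
    by (intro sum.cong refl) (simp add: \<Psi>_x algebra_simps)
  also have "\<dots> = \<sigma> (v $ k) + \<pi> * (\<Sum>j\<in>UNIV. \<sigma> (v $ j) * ev (\<delta>G i (?x $ k $ j)))"
    by (simp add: sum.distrib sum_distrib_left)
  also have "\<sigma> (v $ k) = (v $ k) ^ (p ^ s) + \<pi> * (P / \<pi> * D (v $ k))"
    using B(4) by (simp add: \<sigma>_eq)
  \<comment> \<open>Evaluation comes before the cancellation of \<pi>, which therefore takes place
    in a field and not in \<open>A\<close>.\<close>
  finally have "\<pi> * ev (\<delta>G i F) =
      \<pi> * (P / \<pi> * D (v $ k) + (\<Sum>j\<in>UNIV. \<sigma> (v $ j) * ev (\<delta>G i (?x $ k $ j))))"
    by (simp add: distrib_left)
  then show ?thesis using B(4) by (simp add: F_def)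
qed

theorem theorem3p17:
  fixes p s :: nat
    and Zp R R\<pi> E :: "'k::{alg_closed_field,field_char_0} set"
    and \<phi> :: "'k \<Rightarrow> 'k"
    and \<pi> :: 'k
    and \<theta> :: "'n::{finite,linorder} \<Rightarrow> 'k"
    and r :: "('k, 'n) vec"
    and \<delta> :: "'n \<Rightarrow> 'k \<Rightarrow> 'k"
    and h :: "('n, 'k) matpoly fract \<Rightarrow> 'a::comm_ring_1"
    and A :: "'a set"
    and ev :: "'a \<Rightarrow> 'k"
    and \<delta>G :: "'n \<Rightarrow> 'a \<Rightarrow> 'a"
    and c0 :: "('k, 'n) vec"
  assumes "prime p" and "odd p"
    and "is_Zp p Zp"
    and "is_completed_Zp_ur p Zp R"
    and "frobenius_lift p R \<phi>"
    and "finite_galois (fraction_field Zp) E"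
    and "prime_element (integral_closure Zp E) \<pi>"
    and "R\<pi> = ring_adjoin R \<pi>"
    and "extension_degree (ring_adjoin R (1 / of_nat p)) (field_adjoin (ring_adjoin R (1 / of_nat p)) \<pi>) CARD('n)"
    and "is_basis R UNIV \<theta> R\<pi>"
    and "r \<in> curves R" and "of_nat p / \<pi> = (\<Sum>l\<in>UNIV. r $ l * \<theta> l)"
    and "s \<ge> 1"
    and "\<And>i. higher_pi_derivation p s \<pi> (of_nat p / \<pi>) R\<pi> (\<delta> i)"
    and "is_padic_completion p (GL_ring R\<pi>) h A"
    and "eval_at_one R\<pi> h A ev"
    and "pi_connection p s \<pi> R\<pi> h A \<delta> \<delta>G"
    and "c0 \<in> curves R" and "nondegenerate p \<phi> s R r c0"
  shows "\<exists>!c. c \<in> curves R \<and> nondegenerate p \<phi> s R r c \<and> geodesic p \<phi> s R \<theta> h ev \<delta>G c \<and>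
           vec_cong R p c c0 \<and> vec_cong R p (velocity p \<phi> s c) (velocity p \<phi> s c0)"
proof -
  define \<sigma> where "\<sigma> = \<phi> ^^ s"
  have strict: "strict_p_ring p R" and ZpR: "Zp \<subseteq> R"
    using completed_Zp_ur_strict_p_ring assms by blast+
  interpret frobenius_power p R \<sigma> s
    unfolding \<sigma>_def using frobenius_lift_power strict assms by blast
  note basis = assms(10) and r = assms(11) and der = assms(14)
  have B: "is_subring R\<pi>" and \<pi>_in: "\<pi> \<in> R\<pi>" and RB: "R \<subseteq> R\<pi>"
    using ring_adjoin_subring[OF R] ring_adjoin_self[OF R] ring_adjoin_const[OF R] assms(8) by auto
  have \<pi>0: "\<pi> \<noteq> 0" using assms(7) by (simp add: prime_element_def)
  have \<rho>_in: "P / \<pi> \<in> R\<pi>" unfolding assms(12) by (rule basis_combination_in[OF R basis r])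
  have \<pi>\<rho>: "\<pi> * (P / \<pi>) = P" using \<pi>0 by simp
  have E: "is_subfield E"
    using assms(6) by (auto simp: finite_galois_def finite_extension_def extension_degree_def)
  obtain e where "cong_in (ring_adjoin Zp \<pi>) P (\<pi> ^ e) 0"
    using prime_element_power_dvd[OF assms(3) prime_gt_0_nat[OF p] E assms(7)] by blast
  \<comment> \<open>The divisibility was found over \<open>Zp\<close>, whose residues modulo
    \<open>p\<close> are finite, and is now carried into the larger ring
    \<open>R\<pi>\<close>.\<close>
  then have nil: "cong_in R\<pi> P (\<pi> ^ e) 0"
    using cong_in_mono ring_adjoin_least[OF B subset_trans[OF ZpR RB] \<pi>_in] by blast
  have restrict: "a ^ (p ^ s) + \<pi> * \<delta> i a = \<sigma> a" if "a \<in> R" for i a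
    by (rule pi_derivation_restrict[OF B \<pi>_in \<rho>_in \<pi>\<rho> RB nil basis der that])
  have \<delta>_in: "\<delta> i b \<in> R\<pi>" if "b \<in> R\<pi>" for i b
    using der[of i] that by (auto simp: higher_pi_derivation_def)
  have h: "ring_hom_on (GL_ring R\<pi>) A h" and A: "is_subring A"
    using assms(15) by (auto simp: is_padic_completion_def)
  have e: "ring_hom_on A R\<pi> ev" and ev_c: "\<And>b. b \<in> R\<pi> \<Longrightarrow> ev (const_image h b) = b"
    using assms(16) by (auto simp: eval_at_one_def)
  have \<delta>G_in: "\<delta>G i F \<in> A" if "F \<in> A" for i F
    using assms(17) that unfolding pi_connection_def higher_pi_derivation_def
    by (meson image_subset_iff)
  have x_in: "coord_matrix h $ k $ j \<in> A" for k j
    using ring_hom_onD(1)[OF h matpoly_vars_in_GL_ring[OF B]] by (simp add: coord_matrix_def)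
  have const_in: "const_image h b \<in> A" if "b \<in> R\<pi>" for b
    using ring_hom_onD(1)[OF const_image_hom[OF h B] that] .
  define \<Gamma> where "\<Gamma> = (\<lambda>i k j. ev (\<delta>G i (coord_matrix h $ k $ j)))"
  have \<Gamma>_in: "\<Gamma> i k j \<in> R\<pi>" for i k j
    unfolding \<Gamma>_def by (intro ring_hom_onD(1)[OF e] \<delta>G_in x_in)
  define U where "U = (\<lambda>c v :: ('k, 'n) vec. (\<Sum>i\<in>UNIV. \<sigma> (v $ i)) * (\<Sum>l\<in>UNIV. r $ l * c $ l))"
  define N where "N = (\<lambda>(c :: ('k, 'n) vec) (v :: ('k, 'n) vec) k. \<Sum>i\<in>UNIV. \<sigma> (v $ i) *
    (\<Sum>j\<in>UNIV. \<sigma> (v $ j) * curve_pullback R \<theta> c (\<Gamma> i k j)))"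
  have vel: "velocity p \<phi> s c = (\<chi> i. D (c $ i))" for c :: "('k, 'n) vec"
    unfolding velocity_def delta_def D_def by (simp add: \<sigma>_def)
  have vel_in: "velocity p \<phi> s c \<in> curves R" if "c \<in> curves R" for c :: "('k, 'n) vec"
    using that by (auto simp: vel curves_def intro: D_in)
  have geodesic_iff: "geodesic p \<phi> s R \<theta> h ev \<delta>G c \<longleftrightarrow> (\<forall>k. U c (velocity p \<phi> s c) *
      D (velocity p \<phi> s c $ k) + N c (velocity p \<phi> s c) k = 0)" if c: "c \<in> curves R" for c
  proof -
    define v where "v = velocity p \<phi> s c"
    have v: "v \<in> curves R" unfolding v_def by (rule vel_in[OF c])
    have v_in: "v $ j \<in> R" "\<sigma> (v $ j) \<in> R" "\<sigma> (v $ j) \<in> R\<pi>" for j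
      using v \<sigma>_in RB by (auto simp: curves_def)
    have "curve_pullback R \<theta> c (ev (directional h \<phi> s \<delta>G v
        ((coord_matrix h *v (\<chi> j. const_image h (v $ j))) $ k))) =
      U c v * D (v $ k) + N c v k" for k
    proof -
      define F where "F = (coord_matrix h *v (\<chi> j. const_image h (v $ j))) $ k"
      have F: "F \<in> A"
        unfolding F_def matrix_vector_mult_def vec_lambda_beta
        using RB v_in(1) by (intro subring_sum subring_mult A x_in const_in) auto
      \<comment> \<open>The first summand does not depend on i. Summation with weights
        \<open>\<sigma> (v $ i)\<close> therefore attaches the factor \<Sum>
        \<open>\<sigma> (v $ i)\<close> of \<open>U\<close> to it.\<close>
      define y where "y = (\<lambda>i. D (v $ k) * (P / \<pi>) + (\<Sum>j\<in>UNIV. \<sigma> (v $ j) * \<Gamma> i k j))"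
      have y_in: "D (v $ k) * (P / \<pi>) \<in> R\<pi>" "(\<Sum>j\<in>UNIV. \<sigma> (v $ j) * \<Gamma> i k j) \<in> R\<pi>" for i
        by (intro subring_mult subring_sum B \<rho>_in v_in \<Gamma>_in subsetD[OF RB] D_in)+
      have y: "y i \<in> R\<pi>" for i unfolding y_def by (intro subring_add B y_in)
      have cp_y: "curve_pullback R \<theta> c (y i) = D (v $ k) * (\<Sum>l\<in>UNIV. r $ l * c $ l) +
          (\<Sum>j\<in>UNIV. \<sigma> (v $ j) * curve_pullback R \<theta> c (\<Gamma> i k j))" for i
      proof -
        \<comment> \<open>This produces the other factor of \<open>U\<close>: the curve sends
          \<open>P / \<pi>\<close> to the sum occurring in the first non-degeneracy
          condition.\<close>
        have "coords R \<theta> (P / \<pi>) = r" unfolding assms(12) by (rule coords_combination[OF R basis r])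
        then have "curve_pullback R \<theta> c (P / \<pi>) = (\<Sum>l\<in>UNIV. r $ l * c $ l)"
          by (simp add: curve_pullback_def)
        moreover have "curve_pullback R \<theta> c (\<Sum>j\<in>UNIV. \<sigma> (v $ j) * \<Gamma> i k j) =
            (\<Sum>j\<in>UNIV. \<sigma> (v $ j) * curve_pullback R \<theta> c (\<Gamma> i k j))"
          by (intro curve_pullback_sum[OF R basis] v_in \<Gamma>_in)
        ultimately show ?thesis
          unfolding y_def curve_pullback_add[OF R basis y_in]
            curve_pullback_scale[OF R basis D_in[OF v_in(1)] \<rho>_in] by simp
      qed
      have "ev (\<delta>G i F) = y i" for i
        unfolding F_def y_def \<Gamma>_def
        using pi_connection_at_one[OF B \<pi>_in \<rho>_in \<pi>0 RB h A assms(16,17) restrict \<delta>_in v]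
        by (simp add: mult.commute)
      moreover have "ev (directional h \<phi> s \<delta>G v F) = (\<Sum>i\<in>UNIV. \<sigma> (v $ i) * ev (\<delta>G i F))"
        unfolding directional_def \<sigma>_def[symmetric]
        by (subst ring_hom_on_sum[OF e A])
          (auto simp: ring_hom_onD(4)[OF e const_in[OF v_in(3)] \<delta>G_in[OF F]] ev_c v_in
            intro!: subring_mult A const_in \<delta>G_in F)
      ultimately have "curve_pullback R \<theta> c (ev (directional h \<phi> s \<delta>G v F)) =
          (\<Sum>i\<in>UNIV. \<sigma> (v $ i) * curve_pullback R \<theta> c (y i))"
        using curve_pullback_sum[OF R basis, of UNIV "\<lambda>i. \<sigma> (v $ i)" y] v_in y by simp
      also have "\<dots> = (\<Sum>i\<in>UNIV. \<sigma> (v $ i) * (D (v $ k) * (\<Sum>l\<in>UNIV. r $ l * c $ l) +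
          (\<Sum>j\<in>UNIV. \<sigma> (v $ j) * curve_pullback R \<theta> c (\<Gamma> i k j))))"
        by (simp only: cp_y)
      also have "\<dots> = U c v * D (v $ k) + N c v k"
      proof -
        have "(\<Sum>i\<in>UNIV. f i * (d * x + g i)) = sum f UNIV * x * d + (\<Sum>i\<in>UNIV. f i * g i)"
          for f g :: "'n \<Rightarrow> 'k" and d x
          by (simp add: sum.distrib sum_distrib_left algebra_simps)
        then show ?thesis unfolding U_def N_def .
      qed
      finally show ?thesis unfolding F_def .
    qed
    then show ?thesis unfolding geodesic_def Let_def v_def by simp
  qed
  have r_in: "r $ l \<in> R" for l using r by (simp add: curves_def)
  have pull_in: "curve_pullback R \<theta> c (\<Gamma> i k j) \<in> R" if "c \<in> curves R" for c i k j
    using that coords(1)[OF R basis \<Gamma>_in] unfolding curve_pullback_def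
    by (intro subring_sum subring_mult R) (auto simp: curves_def)
  have sum_r_cong: "cong_in R m (\<Sum>l\<in>UNIV. r $ l * c $ l) (\<Sum>l\<in>UNIV. r $ l * c' $ l)"
    if "\<And>i. cong_in R m (c $ i) (c' $ i)" "c' \<in> curves R" for m and c c' :: "('k, 'n) vec"
    using that by (intro cong_in_sum cong_in_mult cong_in_refl R r_in) (auto simp: curves_def)
  define near where "near = (\<lambda>c v. c \<in> curves R \<and> v \<in> curves R \<and> vec_cong R p c c0 \<and>
    vec_cong R p v (velocity p \<phi> s c0))"
  \<comment> \<open>Non-degeneracy depends only on the residues of c and of its velocity, so it
    spreads from c0 to the whole residue class, where it makes \<open>U\<close> invertible.\<close>
  have nondeg: "\<not> cong_in R P (\<Sum>l\<in>UNIV. r $ l * c $ l) 0 \<and> \<not> cong_in R P (\<Sum>l\<in>UNIV. v $ l) 0"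
    if "near c v" for c v
  proof -
    have "cong_in R P (\<Sum>l\<in>UNIV. r $ l * c $ l) (\<Sum>l\<in>UNIV. r $ l * c0 $ l)"
      by (rule sum_r_cong) (use that assms(18) in \<open>auto simp: near_def vec_cong_def\<close>)
    moreover have "cong_in R P (\<Sum>l\<in>UNIV. v $ l) (\<Sum>l\<in>UNIV. velocity p \<phi> s c0 $ l)"
      by (rule cong_in_sum[OF R]) (use that in \<open>auto simp: near_def vec_cong_def\<close>)
    ultimately show ?thesis
      using assms(19) cong_in_trans[OF R] cong_in_sym[OF R] unfolding nondegenerate_def by blast
  qed
  have "\<exists>!c. near c (velocity p \<phi> s c) \<and>
    (\<forall>k. U c (velocity p \<phi> s c) * D (velocity p \<phi> s c $ k) + N c (velocity p \<phi> s c) k = 0)"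
    unfolding near_def vel
  proof (rule second_order_equation[OF assms(18)])
    fix c v :: "('k, 'n) vec" and k
    assume cv: "c \<in> curves R" "v \<in> curves R"
    then have v_in: "\<sigma> (v $ j) \<in> R" for j by (auto simp: curves_def intro: \<sigma>_in)
    show "N c v k \<in> R"
      unfolding N_def by (intro subring_sum subring_mult R v_in pull_in cv)
  next
    fix c v c' v' :: "('k, 'n) vec" and m k
    assume cv: "c \<in> curves R" "v \<in> curves R" "c' \<in> curves R" "v' \<in> curves R"
      and cc: "\<And>i. cong_in R (P ^ m) (c $ i) (c' $ i)" and vv: "\<And>i. cong_in R (P ^ m) (v $ i) (v' $ i)"
    have v_in: "\<sigma> (v $ j) \<in> R" "\<sigma> (v' $ j) \<in> R" for j
      using cv by (auto simp: curves_def intro: \<sigma>_in)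
    have s_cong: "cong_in R (P ^ m) (\<sigma> (v $ j)) (\<sigma> (v' $ j))" for j
      using cv vv by (intro \<sigma>_cong) (auto simp: curves_def)
    have "cong_in R (P ^ m) (curve_pullback R \<theta> c (\<Gamma> i k j)) (curve_pullback R \<theta> c' (\<Gamma> i k j))" for i j
      unfolding curve_pullback_def using cv cc coords(1)[OF R basis \<Gamma>_in]
      by (intro cong_in_sum cong_in_mult cong_in_refl R) (auto simp: curves_def)
    then show "cong_in R (P ^ m) (N c v k) (N c' v' k)"
      unfolding N_def
      by (intro cong_in_sum cong_in_mult R s_cong v_in pull_in cv subring_sum subring_mult)
    show "cong_in R (P ^ m) (U c v) (U c' v')"
      unfolding U_def using cv
      by (intro cong_in_mult cong_in_sum sum_r_cong R s_cong cc subring_sum subring_mult v_in r_in)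
        (auto simp: curves_def)
  next
    fix c v :: "('k, 'n) vec"
    assume "c \<in> curves R \<and> v \<in> curves R \<and> vec_cong R p c c0 \<and> vec_cong R p v (\<chi> i. D (c0 $ i))"
    then have near: "near c v" and cv: "c $ i \<in> R" "v $ i \<in> R" for i
      by (auto simp: near_def vel curves_def)
    \<comment> \<open>The second non-degeneracy condition concerns the sum of the velocities, while
      \<open>U\<close> contains the sum of their images; additivity of \<sigma> and its reflection
      of zero modulo P connect the two.\<close>
    have "(\<Sum>i\<in>UNIV. \<sigma> (v $ i)) = \<sigma> (\<Sum>i\<in>UNIV. v $ i)"
      using ring_hom_on_sum[OF hom R, of UNIV "($) v"] cv by simp
    then have "\<not> cong_in R P (\<Sum>i\<in>UNIV. \<sigma> (v $ i)) 0"
      using \<sigma>_cong_zero[of "\<Sum>i\<in>UNIV. v $ i" 1] nondeg[OF near] cv R by (auto intro: subring_sum)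
    moreover have "(\<Sum>i\<in>UNIV. \<sigma> (v $ i)) \<in> R" "(\<Sum>l\<in>UNIV. r $ l * c $ l) \<in> R"
      by (auto intro!: subring_sum subring_mult R \<sigma>_in cv r_in)
    ultimately show "inverse (U c v) \<in> R \<and> U c v \<noteq> 0"
      using not_cong_imp_unit nondeg[OF near] unfolding U_def
      by (auto simp: inverse_mult_distrib intro!: subring_mult R)
  qed
  moreover have "c \<in> curves R \<and> nondegenerate p \<phi> s R r c \<and> geodesic p \<phi> s R \<theta> h ev \<delta>G c \<and>
      vec_cong R p c c0 \<and> vec_cong R p (velocity p \<phi> s c) (velocity p \<phi> s c0) \<longleftrightarrow>
    near c (velocity p \<phi> s c) \<and>
    (\<forall>k. U c (velocity p \<phi> s c) * D (velocity p \<phi> s c $ k) + N c (velocity p \<phi> s c) k = 0)" for c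
    using geodesic_iff[of c] vel_in[of c] nondeg[of c "velocity p \<phi> s c"]
    unfolding near_def nondegenerate_def by blast
  ultimately show ?thesis by simp
qed

end
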